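(* Let $k\ge1$ and assume $\mathbb{E}[m_0^{r_k+\varepsilon}]<\infty$ for some $\varepsilon>0$. Then for every $\theta\in(0,\mathbb{E}[X])$, $$\lim_{n\to\infty}-\frac1n\log\mathbb{P}_k\big(Z_n\le e^{\theta n}\big)=\chi_k^*(\theta)\in(0,\infty),$$ where $$\chi_k^*(\theta)=\sup_{\lambda\le0}\{\lambda\theta-\chi_k(\lambda)\}=\begin{cases}-r_k\theta-\log\gamma_k & \text{if } 0<\theta<\theta_k,\\ \Lambda^*(\theta) & \text{if } \theta_k\le\theta<\mathbb{E}[X],\end{cases}$$ with $\chi_k(\lambda)=\log\gamma_k$ for $\lambda\le -r_k$, $\chi_k(\lambda)=\Lambda(\lambda)$ for $\lambda\in[-r_k,0]$, and $\theta_k=\Lambda'(-r_k)$.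
   Context: Branching process in a random environment (BPRE). The environment $\xi=(\xi_0,\xi_1,\dots)$ is i.i.d.; each $\xi_n$ determines an offspring distribution $(p_i(\xi_n))_{i\ge0}$ with generating function $f_n$. $Z_{n+1}=\sum_{i=1}^{Z_n}N_{n,i}$, where conditionally on $\xi$ the $N_{n,i}$ are independent with generating function $f_n$. $\mathbb{P}_k$ is the annealed law (averaged over the environment) with $Z_0=k$. $m_0=\sum_i i\,p_i(\xi_0)$, $X=\log m_0$. Standing assumptions: $p_0(\xi_0)=0$ a.s.; $\mathbb{E}X\in(0,\infty)$; $\mathbb{E}[\frac{Z_1}{m_0}\log^+Z_1]<\infty$ (with $Z_0=1$); $\mathbb{P}(p_1(\xi_0)>0)>0$. $\gamma_k=\mathbb{E}[p_1(\xi_0)^k]$; $r_k\in(0,\infty)$ is the solution of $\mathbb{E}[m_0^{-r_k}]=\gamma_k$ (assumed to exist). $\Lambda(\lambda)=\log\mathbb{E}[e^{\lambda X}]$ is the log-Laplace transform of $X$, and $\Lambda^*(x)=\sup_{\lambda\le0}\{\lambda x-\Lambda(\lambda)\}$. *)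

theory Defs
  imports "HOL-Probability.Probability"
begin

text \<open>Environment space: a probability space M of environments; each environment xi
  determines offspring probabilities p xi i (i :: nat).\<close>

definition offspring :: "('e \<Rightarrow> nat \<Rightarrow> real) \<Rightarrow> 'e \<Rightarrow> nat pmf" where
  "offspring p xi = embed_pmf (p xi)"

fun convpow :: "nat pmf \<Rightarrow> nat \<Rightarrow> nat pmf" where
  "convpow q 0 = return_pmf 0"
| "convpow q (Suc j) = map_pmf (\<lambda>(a, b). a + b) (pair_pmf q (convpow q j))"

text \<open>Quenched law of Z_n given the environment sequence w (w n = xi_n) and Z_0 = k.\<close>
fun Zq :: "('e \<Rightarrow> nat \<Rightarrow> real) \<Rightarrow> nat \<Rightarrow> (nat \<Rightarrow> 'e) \<Rightarrow> nat \<Rightarrow> nat pmf" where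
  "Zq p k w 0 = return_pmf k"
| "Zq p k w (Suc n) = bind_pmf (Zq p k w n) (\<lambda>j. convpow (offspring p (w n)) j)"

definition annP :: "'e measure \<Rightarrow> ('e \<Rightarrow> nat \<Rightarrow> real) \<Rightarrow> nat \<Rightarrow> nat \<Rightarrow> nat set \<Rightarrow> real" where
  "annP M p k n A = (\<integral>w. measure_pmf.prob (Zq p k w n) A \<partial>(PiM {..<n} (\<lambda>_. M)))"

definition mean :: "('e \<Rightarrow> nat \<Rightarrow> real) \<Rightarrow> 'e \<Rightarrow> real" where
  "mean p xi = (\<Sum>i. real i * p xi i)"

definition gam :: "'e measure \<Rightarrow> ('e \<Rightarrow> nat \<Rightarrow> real) \<Rightarrow> nat \<Rightarrow> real" where
  "gam M p k = (\<integral>xi. p xi 1 ^ k \<partial>M)"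

definition LLambda :: "'e measure \<Rightarrow> ('e \<Rightarrow> nat \<Rightarrow> real) \<Rightarrow> real \<Rightarrow> real" where
  "LLambda M p l = ln (\<integral>xi. exp (l * ln (mean p xi)) \<partial>M)"

definition LLambda_star :: "'e measure \<Rightarrow> ('e \<Rightarrow> nat \<Rightarrow> real) \<Rightarrow> real \<Rightarrow> ereal" where
  "LLambda_star M p x = (SUP l\<in>{..0::real}. ereal (l * x - LLambda M p l))"

definition chi :: "'e measure \<Rightarrow> ('e \<Rightarrow> nat \<Rightarrow> real) \<Rightarrow> nat \<Rightarrow> real \<Rightarrow> real \<Rightarrow> real" where
  "chi M p k r l = (if l \<le> - r then ln (gam M p k) else LLambda M p l)"

definition chi_star :: "'e measure \<Rightarrow> ('e \<Rightarrow> nat \<Rightarrow> real) \<Rightarrow> nat \<Rightarrow> real \<Rightarrow> real \<Rightarrow> ereal" where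
  "chi_star M p k r x = (SUP l\<in>{..0::real}. ereal (l * x - chi M p k r l))"

end

theory Submission
  imports Defs
begin

text \<open>Averaged over the environment, \<open>Z\<close> is a nondecreasing Markov chain with kernel \<open>Q\<close>, and
  everything follows from the growth rate of its harmonic moments \<open>E[Z_n powr (- s)]\<close> for
  \<open>0 < s < r\<close>, which is \<open>LLambda (- s)\<close>. Jensen's inequality gives the lower bound. For the
  upper bound, the law of large numbers for one generation shows that \<open>V s z = z powr (- s)\<close>
  contracts by a factor close to \<open>E[m powr (- s)]\<close> when \<open>z\<close> is large. Since \<open>gam k\<close> is smaller
  than this factor, \<open>V s\<close> can be modified at finitely many states into a Lyapunov function that
  contracts everywhere.

  The upper bound on \<open>P (Z_n \<le> exp (theta n))\<close> is then Markov's inequality. The lower bound comes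
  from a Gaertner-Ellis argument for \<open>log Z_n\<close> at slopes of \<open>LLambda\<close> in \<open>(- r, 0)\<close>, combined
  with keeping the population at size \<open>k\<close> for a positive fraction of the time, which costs
  \<open>gam k\<close> per generation.\<close>

section \<open>Convolution powers\<close>

text \<open>Every individual leaves at least one child, so the chain never decreases. Bounding
  \<open>V s\<close> by its starting value and treating finitely many states one by one both rest on
  this.\<close>

lemma convpow_support:
  assumes "0 \<notin> set_pmf q" "z \<in> set_pmf (convpow q j)"
  shows "j \<le> z"
  using assms(2)
proof (induction j arbitrary: z)
  case (Suc j)
  then obtain a b where "a \<in> set_pmf q" "b \<in> set_pmf (convpow q j)" "z = a + b"
    by auto
  moreover from this have "j \<le> b" "a \<noteq> 0"
    using Suc.IH assms(1) by (auto intro: gr0I)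
  ultimately show ?case by simp
qed simp

text \<open>A finite sum: measurability in the environment then follows by induction on the
  population size.\<close>

lemma pmf_convpow_Suc:
  "pmf (convpow q (Suc j)) z = (\<Sum>a\<le>z. pmf q a * pmf (convpow q j) (z - a))"
proof -
  have "ennreal (pmf (convpow q (Suc j)) z)
      = (\<integral>\<^sup>+a. \<integral>\<^sup>+b. indicator {z} (a + b) \<partial>convpow q j \<partial>q)"
    by (simp add: ennreal_pmf_map nn_integral_pair_pmf' vimage_def indicator_def
        case_prod_unfold of_bool_def)
  also have "\<dots> = (\<integral>\<^sup>+a. ennreal (pmf (convpow q j) (z - a)) * indicator {..z} a \<partial>q)"
  proof (intro nn_integral_cong)
    fix a
    have "indicator {z} (a + b) = (indicator {z - a} b * indicator {..z} a :: ennreal)" for b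
      by (auto simp: indicator_def)
    then show "(\<integral>\<^sup>+b. indicator {z} (a + b) \<partial>convpow q j)
        = ennreal (pmf (convpow q j) (z - a)) * indicator {..z} a"
      by (simp add: nn_integral_multc emeasure_pmf_single)
  qed
  also have "\<dots> = (\<Sum>a\<le>z. ennreal (pmf (convpow q j) (z - a)) * ennreal (pmf q a))"
    by (subst nn_integral_indicator_finite) (auto simp: emeasure_pmf_single)
  also have "\<dots> = ennreal (\<Sum>a\<le>z. pmf q a * pmf (convpow q j) (z - a))"
    by (subst sum_ennreal[symmetric]) (auto simp: ennreal_mult mult.commute)
  finally show ?thesis
    by (subst (asm) ennreal_inj) (auto intro: sum_nonneg)
qed

text \<open>Without deaths, \<open>j\<close> individuals have \<open>j\<close> children in all only
  if each has exactly one.\<close>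

lemma pmf_convpow_diag:
  assumes "pmf q 0 = 0"
  shows "pmf (convpow q j) j = pmf q 1 ^ j"
proof (induction j)
  case (Suc j)
  have 0: "0 \<notin> set_pmf q" using assms by (simp add: set_pmf_iff)
  have "pmf q a * pmf (convpow q j) (Suc j - a) = (if a = 1 then pmf q 1 ^ Suc j else 0)"
    if "a \<le> Suc j" for a
  proof (cases "a \<le> 1")
    case False
    then have "Suc j - a \<notin> set_pmf (convpow q j)"
      using convpow_support[OF 0, of "Suc j - a" j] that by fastforce
    then show ?thesis using False by (simp add: set_pmf_iff)
  next
    case True
    then consider "a = 0" | "a = 1" by linarith
    then show ?thesis using assms Suc by cases auto
  qed
  then have "pmf (convpow q (Suc j)) (Suc j) = (\<Sum>a\<le>Suc j. if a = 1 then pmf q 1 ^ Suc j else 0)"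
    unfolding pmf_convpow_Suc by (intro sum.cong) auto
  then show ?case by simp
qed simp

lemma nn_integral_convpow_prod:
  fixes f :: "nat \<Rightarrow> ennreal"
  assumes "f 0 = 1" "\<And>a b. f (a + b) = f a * f b"
  shows "(\<integral>\<^sup>+z. f z \<partial>convpow q j) = (\<integral>\<^sup>+z. f z \<partial>q) ^ j"
  by (induction j) (simp_all add: assms nn_integral_pair_pmf' nn_integral_cmult nn_integral_multc case_prod_unfold)

lemma nn_integral_convpow_mean:
  "(\<integral>\<^sup>+z. of_nat z \<partial>convpow q j) = of_nat j * (\<integral>\<^sup>+z. of_nat z \<partial>q)"
  by (induction j) (simp_all add: nn_integral_pair_pmf' nn_integral_add case_prod_unfold distrib_right)

text \<open>Cramer's bound on the lower tail, which replaces the weak law of large numbers: for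
  \<open>a\<close> below the mean, \<open>exp (t a) E[exp (- t N)] < 1\<close> for small \<open>t > 0\<close>.\<close>
lemma convpow_lower_tail:
  fixes q :: "nat pmf" and a :: real
  assumes "summable (\<lambda>i. real i * pmf q i)" "a < (\<Sum>i. real i * pmf q i)"
  shows "(\<lambda>j. measure (measure_pmf (convpow q j)) {z. real z \<le> a * real j}) \<longlonglongrightarrow> 0"
proof -
  have "(\<lambda>L. \<Sum>i<L. real i * pmf q i) \<longlonglongrightarrow> (\<Sum>i. real i * pmf q i)"
    using assms(1) by (rule summable_LIMSEQ)
  from order_tendstoD(1)[OF this assms(2)]
  obtain L where L: "a < (\<Sum>i<L. real i * pmf q i)"
    by (auto simp: eventually_sequentially)
  \<comment> \<open>\<open>g t\<close> bounds \<open>exp (t a) E[exp (- t N)]\<close>, with values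
    of \<open>N\<close> from \<open>L\<close> on bounded trivially by 1. As a finite sum it can be
    differentiated termwise, and its slope at 0 is \<open>a\<close> minus the truncated mean, hence
    negative.\<close>
  define g where "g = (\<lambda>t. exp (t * a) * (1 - (\<Sum>i<L. pmf q i * (1 - exp (- (t * real i))))))"
  have "(g has_real_derivative a - (\<Sum>i<L. real i * pmf q i)) (at 0)"
    unfolding g_def by (auto intro!: derivative_eq_intros simp: mult_ac)
  from DERIV_neg_dec_right[OF this] L
  obtain d where d: "d > 0" "\<And>h. 0 < h \<Longrightarrow> h < d \<Longrightarrow> g h < g 0" by auto
  define t where "t = d / 2"
  have "g 0 = 1" by (simp add: g_def)
  then have t: "t > 0" "g t < 1" using d(1) d(2)[of t] by (auto simp: t_def)
  define c where "c = (\<integral>\<^sup>+z. ennreal (exp (- (t * real z))) \<partial>q)"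
  have c_le: "c \<le> ennreal (1 - (\<Sum>i<L. pmf q i * (1 - exp (- (t * real i)))))"
    (is "_ \<le> ennreal (1 - ?S)")
  proof -
    let ?h = "\<lambda>i. 1 - exp (- (t * real i))"
    have h: "0 \<le> ?h i" "?h i \<le> 1" for i using t by auto
    have S: "?S \<ge> 0" by (intro sum_nonneg mult_nonneg_nonneg) (use h in auto)
    have "c + ennreal ?S = c + (\<integral>\<^sup>+z. ennreal (?h z) * indicator {..<L} z \<partial>q)"
      by (subst nn_integral_indicator_finite)
        (use h in \<open>auto simp: emeasure_pmf_single ennreal_mult[symmetric] mult.commute sum_ennreal\<close>)
    also have "\<dots> \<le> (\<integral>\<^sup>+z. 1 \<partial>q)"
      unfolding c_def
    proof (subst nn_integral_add[symmetric], simp, simp, intro nn_integral_mono)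
      fix z
      show "ennreal (exp (- (t * real z))) + ennreal (?h z) * indicator {..<L} z \<le> 1"
        using h[of z] t by (auto simp: indicator_def ennreal_plus[symmetric] simp del: ennreal_plus)
    qed
    finally have "c + ennreal ?S \<le> ennreal 1" by simp
    from ennreal_minus_mono[OF this order_refl, of "ennreal ?S"]
    have "c \<le> ennreal 1 - ennreal ?S" by (simp add: ennreal_add_diff_cancel_right)
    then show ?thesis using ennreal_minus[OF S, of 1] by simp
  qed
  \<comment> \<open>The \<open>max\<close> makes the base of the geometric sequence nonnegative
    without a separate sign argument for \<open>g t\<close>.\<close>
  have bound: "measure (measure_pmf (convpow q j)) {z. real z \<le> a * real j} \<le> max 0 (g t) ^ j" for j
  proof -
    have "emeasure (convpow q j) {z. real z \<le> a * real j}
        = (\<integral>\<^sup>+z. indicator {z. real z \<le> a * real j} z \<partial>convpow q j)" by simp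
    also have "\<dots> \<le> (\<integral>\<^sup>+z. ennreal (exp (t * a * real j)) * ennreal (exp (- (t * real z))) \<partial>convpow q j)"
    proof (intro nn_integral_mono)
      fix z
      have "real z \<le> a * real j \<Longrightarrow> t * real z \<le> t * a * real j" using t by simp
      then show "indicator {z. real z \<le> a * real j} z
          \<le> ennreal (exp (t * a * real j)) * ennreal (exp (- (t * real z)))"
        by (auto simp: indicator_def ennreal_mult[symmetric] exp_add[symmetric])
    qed
    also have "\<dots> = ennreal (exp (t * a)) ^ j * c ^ j"
    proof (subst nn_integral_cmult, simp, subst nn_integral_convpow_prod)
      show "ennreal (exp (- (t * real (x + y))))
          = ennreal (exp (- (t * real x))) * ennreal (exp (- (t * real y)))" for x y
        by (simp add: ennreal_mult[symmetric] exp_add[symmetric] distrib_left)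
      show "ennreal (exp (t * a * real j)) * (\<integral>\<^sup>+z. ennreal (exp (- (t * real z))) \<partial>q) ^ j
          = ennreal (exp (t * a)) ^ j * c ^ j"
        by (simp add: c_def ennreal_power exp_of_nat_mult[symmetric] mult_ac)
    qed simp
    also have "\<dots> \<le> (ennreal (exp (t * a)) * ennreal (1 - ?S)) ^ j"
      unfolding power_mult_distrib[symmetric] by (intro power_mono mult_left_mono c_le) auto
    also have "ennreal (exp (t * a)) * ennreal (1 - ?S) = ennreal (g t)"
      by (simp add: g_def ennreal_mult'[symmetric])
    also have "ennreal (g t) ^ j = ennreal (max 0 (g t) ^ j)"
      by (subst ennreal_power[symmetric]) simp_all
    finally show ?thesis
      by (subst (asm) measure_pmf.emeasure_eq_measure, subst (asm) ennreal_le_iff) simp_all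
  qed
  show ?thesis
  proof (rule tendsto_sandwich[OF _ _ tendsto_const])
    show "(\<lambda>j. max 0 (g t) ^ j) \<longlonglongrightarrow> 0" using t by (intro LIMSEQ_power_zero) auto
  qed (use bound in auto)
qed

section \<open>The annealed chain\<close>

text \<open>The probability axioms hold at every point of the space, so that
  \<open>embed_pmf\<close> yields the intended law everywhere; absence of deaths and finiteness of
  the mean hold only almost surely.\<close>

locale branching_env = prob_space M for M :: "'e measure" +
  fixes p :: "'e \<Rightarrow> nat \<Rightarrow> real"
  assumes p_meas [measurable]: "\<And>i. (\<lambda>xi. p xi i) \<in> borel_measurable M"
    and p_nonneg: "\<And>xi i. xi \<in> space M \<Longrightarrow> 0 \<le> p xi i"
    and p_sums: "\<And>xi. xi \<in> space M \<Longrightarrow> p xi sums 1"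
    and p0: "AE xi in M. p xi 0 = 0"
    and mean_fin: "AE xi in M. summable (\<lambda>i. real i * p xi i)"
begin

section \<open>Measurability of offspring sums in the environment\<close>

lemma pmf_offspring:
  assumes "xi \<in> space M"
  shows "pmf (offspring p xi) i = p xi i"
  unfolding offspring_def
proof (rule pmf_embed_pmf)
  show "(\<integral>\<^sup>+ x. ennreal (p xi x) \<partial>count_space UNIV) = 1"
    using p_sums[OF assms] p_nonneg[OF assms]
    by (simp add: nn_integral_count_space_nat suminf_ennreal2 sums_iff)
qed (rule p_nonneg[OF assms])

lemma measurable_pmf_convpow [measurable]:
  "(\<lambda>xi. pmf (convpow (offspring p xi) j) i) \<in> borel_measurable M"
proof (induction j arbitrary: i)
  case (Suc j)
  note [measurable] = this
  have "(\<lambda>xi. \<Sum>a\<le>i. p xi a * pmf (convpow (offspring p xi) j) (i - a)) \<in> borel_measurable M"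
    by measurable
  then show ?case
    unfolding pmf_convpow_Suc
    by (rule measurable_cong[THEN iffD1, rotated]) (simp add: pmf_offspring)
qed (simp add: pmf_return)

lemma measurable_nn_integral_convpow [measurable]:
  "(\<lambda>xi. \<integral>\<^sup>+z. f z \<partial>convpow (offspring p xi) j) \<in> borel_measurable M"
  unfolding nn_integral_measure_pmf nn_integral_count_space_nat by measurable

text \<open>The transition operator of the annealed chain, acting on functions. Values in
  \<open>ennreal\<close> avoid integrability conditions and permit Lyapunov functions with value
  \<open>\<top>\<close>.\<close>

definition Q :: "(nat \<Rightarrow> ennreal) \<Rightarrow> nat \<Rightarrow> ennreal" where
  "Q f j = (\<integral>\<^sup>+xi. \<integral>\<^sup>+z. f z \<partial>convpow (offspring p xi) j \<partial>M)"

section \<open>Monotonicity, linearity and iteration of the annealed operator\<close>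

lemma Q_mono: "(\<And>z. f z \<le> g z) \<Longrightarrow> Q f j \<le> Q g j"
  unfolding Q_def by (intro nn_integral_mono) auto

lemma Q_cmult: "Q (\<lambda>z. c * f z) j = c * Q f j"
  unfolding Q_def by (simp add: nn_integral_cmult)

lemma Q_add: "Q (\<lambda>z. f z + g z) j = Q f j + Q g j"
  unfolding Q_def by (simp add: nn_integral_add)

lemma Qn_mono: "(\<And>z. f z \<le> g z) \<Longrightarrow> (Q ^^ n) f j \<le> (Q ^^ n) g j"
  by (induction n arbitrary: j) (auto intro: Q_mono)

lemma Qn_cmult: "(Q ^^ n) (\<lambda>z. c * f z) j = c * (Q ^^ n) f j"
proof (induction n arbitrary: j)
  case (Suc n)
  then have "(Q ^^ n) (\<lambda>z. c * f z) = (\<lambda>j. c * (Q ^^ n) f j)" by blast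
  then show ?case by (simp add: Q_cmult)
qed simp

lemma Qn_add: "(Q ^^ n) (\<lambda>z. f z + g z) j = (Q ^^ n) f j + (Q ^^ n) g j"
proof (induction n arbitrary: j)
  case (Suc n)
  then have "(Q ^^ n) (\<lambda>z. f z + g z) = (\<lambda>j. (Q ^^ n) f j + (Q ^^ n) g j)" by blast
  then show ?case by (simp add: Q_add)
qed simp

lemma Qn_upper:
  assumes "\<And>z. Q f z \<le> c * f z"
  shows "(Q ^^ n) f j \<le> c ^ n * f j"
proof (induction n arbitrary: j)
  case (Suc n)
  have "(Q ^^ Suc n) f j \<le> Q (\<lambda>z. c ^ n * f z) j"
    using Q_mono[OF Suc] by simp
  also have "\<dots> \<le> c ^ n * (c * f j)" unfolding Q_cmult by (intro mult_left_mono assms) auto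
  finally show ?case by (simp add: mult_ac)
qed simp

lemma Qn_lower:
  assumes "\<And>z. c * f z \<le> Q f z"
  shows "c ^ n * f j \<le> (Q ^^ n) f j"
proof (induction n arbitrary: j)
  case (Suc n)
  have "c ^ Suc n * f j = c ^ n * (c * f j)" by (simp add: mult_ac)
  also have "\<dots> \<le> c ^ n * Q f j" by (intro mult_left_mono assms) auto
  also have "\<dots> = Q (\<lambda>z. c ^ n * f z) j" by (simp add: Q_cmult)
  also have "\<dots> \<le> (Q ^^ Suc n) f j"
    using Q_mono[OF Suc] by simp
  finally show ?case .
qed simp

section \<open>From quenched laws to iterates of the annealed operator\<close>

lemma Zq_cong: "(\<And>i. i < n \<Longrightarrow> w i = w' i) \<Longrightarrow> Zq p k w n = Zq p k w' n"
  by (induction n) auto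

lemma measurable_pmf_Zq [measurable]:
  "(\<lambda>w. pmf (Zq p k w n) i) \<in> borel_measurable (PiM {..<n} (\<lambda>_. M))"
proof (induction n arbitrary: i)
  case (Suc n)
  have [measurable]: "(\<lambda>w. w n) \<in> measurable (PiM {..<Suc n} (\<lambda>_. M)) M"
    by (rule measurable_component_singleton) simp
  have [measurable]: "(\<lambda>w. pmf (Zq p k w n) j) \<in> borel_measurable (PiM {..<Suc n} (\<lambda>_. M))" for j
  proof -
    \<comment> \<open>The induction hypothesis concerns the product over \<open>{..<n}\<close>; it
      is pulled back along the restriction map, which leaves the law at time \<open>n\<close>
      unchanged.\<close>
    have "(\<lambda>w. pmf (Zq p k (restrict w {..<n}) n) j) \<in> borel_measurable (PiM {..<Suc n} (\<lambda>_. M))"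
      by (rule measurable_compose[OF measurable_restrict_subset Suc]) auto
    also have "(\<lambda>w. pmf (Zq p k (restrict w {..<n}) n) j) = (\<lambda>w. pmf (Zq p k w n) j)"
      by (intro ext arg_cong[where f = "\<lambda>q. pmf q j"] Zq_cong) auto
    finally show ?thesis .
  qed
  have "(\<lambda>w. \<integral>\<^sup>+j. ennreal (pmf (convpow (offspring p (w n)) j) i) \<partial>Zq p k w n)
      \<in> borel_measurable (PiM {..<Suc n} (\<lambda>_. M))"
    unfolding nn_integral_measure_pmf nn_integral_count_space_nat by measurable
  then have "(\<lambda>w. enn2real (\<integral>\<^sup>+j. ennreal (pmf (convpow (offspring p (w n)) j) i) \<partial>Zq p k w n))
      \<in> borel_measurable (PiM {..<Suc n} (\<lambda>_. M))"
    by measurable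
  then show ?case
    by (simp add: ennreal_pmf_bind[symmetric])
qed (simp add: pmf_return)

lemma measurable_nn_integral_Zq [measurable]:
  "(\<lambda>w. \<integral>\<^sup>+z. f z \<partial>Zq p k w n) \<in> borel_measurable (PiM {..<n} (\<lambda>_. M))"
  unfolding nn_integral_measure_pmf nn_integral_count_space_nat by measurable

text \<open>The last environment is independent of the earlier ones. Integrating it out first by
  Fubini replaces \<open>f\<close> by \<open>Q f\<close>, so the induction runs over arbitrary
  \<open>f\<close>.\<close>

lemma nn_integral_Zq:
  "(\<integral>\<^sup>+w. \<integral>\<^sup>+z. f z \<partial>Zq p k w n \<partial>PiM {..<n} (\<lambda>_. M)) = (Q ^^ n) f k"
proof (induction n arbitrary: f)
  case 0
  interpret P: prob_space "PiM {} (\<lambda>_::nat. M)" by (intro prob_space_PiM prob_space_axioms)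
  show ?case using P.emeasure_space_1 by (simp add: nn_integral_return)
next
  case (Suc n)
  interpret product_sigma_finite "\<lambda>_::nat. M" ..
  have ins: "insert n {..<n} = {..<Suc n}" by auto
  have "(\<integral>\<^sup>+w. \<integral>\<^sup>+z. f z \<partial>Zq p k w (Suc n) \<partial>PiM {..<Suc n} (\<lambda>_. M))
     = (\<integral>\<^sup>+w. \<integral>\<^sup>+xi. \<integral>\<^sup>+z. f z \<partial>Zq p k (w(n := xi)) (Suc n) \<partial>M \<partial>PiM {..<n} (\<lambda>_. M))"
    by (subst ins[symmetric], subst product_nn_integral_insert)
       (auto simp: ins simp del: Zq.simps fun_upd_apply)
  also have "\<dots> = (\<integral>\<^sup>+w. \<integral>\<^sup>+j. Q f j \<partial>Zq p k w n \<partial>PiM {..<n} (\<lambda>_. M))"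
  proof (intro nn_integral_cong)
    fix w
    have "Zq p k (w(n := xi)) (Suc n) = bind_pmf (Zq p k w n) (convpow (offspring p xi))" for xi
      using Zq_cong[of n "w(n := xi)" w k] by simp
    then have "(\<integral>\<^sup>+xi. \<integral>\<^sup>+z. f z \<partial>Zq p k (w(n := xi)) (Suc n) \<partial>M)
       = (\<integral>\<^sup>+xi. (\<Sum>j. ennreal (pmf (Zq p k w n) j) * (\<integral>\<^sup>+z. f z \<partial>convpow (offspring p xi) j)) \<partial>M)"
      by (simp add: nn_integral_measure_pmf[of "Zq p k w n"] nn_integral_count_space_nat del: Zq.simps)
    also have "\<dots> = (\<Sum>j. ennreal (pmf (Zq p k w n) j) * Q f j)"
      by (subst nn_integral_suminf) (simp_all add: nn_integral_cmult Q_def)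
    also have "\<dots> = (\<integral>\<^sup>+j. Q f j \<partial>Zq p k w n)"
      by (simp add: nn_integral_measure_pmf nn_integral_count_space_nat)
    finally show "(\<integral>\<^sup>+xi. \<integral>\<^sup>+z. f z \<partial>Zq p k (w(n := xi)) (Suc n) \<partial>M) = (\<integral>\<^sup>+j. Q f j \<partial>Zq p k w n)" .
  qed
  also have "\<dots> = (Q ^^ Suc n) f k"
    unfolding Suc by (simp add: funpow_swap1)
  finally show ?case .
qed

text \<open>All later estimates of annealed probabilities go through this identity instead of the
  product space.\<close>

lemma annP_eq: "ennreal (annP M p k n A) = (Q ^^ n) (indicator A) k"
proof -
  interpret P: prob_space "PiM {..<n} (\<lambda>_. M)" by (intro prob_space_PiM prob_space_axioms)
  have m: "(\<lambda>w. measure_pmf.prob (Zq p k w n) A) \<in> borel_measurable (PiM {..<n} (\<lambda>_. M))"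
  proof -
    have "(\<lambda>w. enn2real (\<integral>\<^sup>+z. indicator A z \<partial>Zq p k w n)) \<in> borel_measurable (PiM {..<n} (\<lambda>_. M))"
      by measurable
    then show ?thesis by (simp add: measure_def)
  qed
  have "(Q ^^ n) (indicator A) k
      = (\<integral>\<^sup>+w. ennreal (measure_pmf.prob (Zq p k w n) A) \<partial>PiM {..<n} (\<lambda>_. M))"
    unfolding nn_integral_Zq[symmetric] by (simp add: measure_pmf.emeasure_eq_measure)
  also have "\<dots> = ennreal (annP M p k n A)"
    unfolding annP_def
    by (rule nn_integral_eq_integral)
      (auto intro!: P.integrable_const_bound[where B = 1] m)
  finally show ?thesis ..
qed

lemma annP_nonneg: "0 \<le> annP M p k n A"
  unfolding annP_def by (rule integral_nonneg_AE) simp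

lemma annP_mono: "A \<subseteq> B \<Longrightarrow> annP M p k n A \<le> annP M p k n B"
  by (subst ennreal_le_iff[symmetric])
    (auto simp: annP_eq annP_nonneg indicator_def intro!: Qn_mono)

end

section \<open>One generation from a large population\<close>

text \<open>Its expectation is the harmonic moment of order \<open>s\<close>. By the convention for
  \<open>powr\<close>, \<open>V s 0 = 0\<close>, which makes state 0 trivial in lower bounds but not
  in Markov's inequality.\<close>

definition V :: "real \<Rightarrow> nat \<Rightarrow> ennreal" where
  "V s z = ennreal (real z powr (- s))"

text \<open>The tangent at \<open>a\<close> lies below the convex function; its linear term stands
  on the right so that every term is nonnegative and can be integrated in
  \<open>ennreal\<close>.\<close>

lemma powr_neg_tangent:
  fixes a x s :: real
  assumes "0 < a" "0 < x" "0 < s"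
  shows "a powr (- s) * (1 + s) \<le> x powr (- s) + a powr (- s) * (s / a) * x"
proof -
  have "1 + s - s * (x / a) \<le> 1 - s * ln (x / a)"
    using ln_le_minus_one[of "x / a"] mult_left_mono[of "ln (x / a)" "x / a - 1" s] assms
    by (simp add: algebra_simps)
  also have "\<dots> \<le> exp (- s * ln (x / a))"
    using exp_ge_add_one_self[of "- s * ln (x / a)"] by simp
  also have "\<dots> = (x / a) powr (- s)" using assms by (simp add: powr_def)
  finally have "a powr (- s) * (1 + s - s * (x / a)) \<le> a powr (- s) * (x / a) powr (- s)"
    by (intro mult_left_mono) auto
  also have "a powr (- s) * (x / a) powr (- s) = x powr (- s)"
    using assms by (simp add: powr_mult[symmetric])
  finally show ?thesis by (simp add: algebra_simps)
qed

text \<open>Jensen's inequality for the convex function \<open>z powr (- s)\<close>, by integrating its tangent at the mean.\<close>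
lemma convpow_V_lower:
  assumes q0: "0 \<notin> set_pmf q" and m: "(\<integral>\<^sup>+z. of_nat z \<partial>q) = ennreal m" "0 < m"
    and j: "0 < j" and s: "0 < s"
  shows "ennreal (m powr (- s)) * V s j \<le> (\<integral>\<^sup>+z. V s z \<partial>convpow q j)"
proof -
  define a where "a = real j * m"
  have a: "a > 0" using m j by (simp add: a_def)
  have "ennreal (a powr (- s) * (1 + s)) = (\<integral>\<^sup>+z. ennreal (a powr (- s) * (1 + s)) \<partial>convpow q j)"
    by simp
  also have "\<dots> \<le> (\<integral>\<^sup>+z. V s z + ennreal (a powr (- s) * (s / a)) * of_nat z \<partial>convpow q j)"
  proof (intro nn_integral_mono_AE, unfold AE_measure_pmf_iff, intro ballI)
    fix z assume "z \<in> set_pmf (convpow q j)"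
    then have "0 < real z" using convpow_support[OF q0] j by fastforce
    from powr_neg_tangent[OF a this s]
    show "ennreal (a powr (- s) * (1 + s)) \<le> V s z + ennreal (a powr (- s) * (s / a)) * of_nat z"
      using a s unfolding V_def ennreal_of_nat_eq_real_of_nat
      by (subst ennreal_mult[symmetric], simp, simp, subst ennreal_plus[symmetric])
        (auto intro: ennreal_leI simp del: ennreal_plus)
  qed
  also have "\<dots> = (\<integral>\<^sup>+z. V s z \<partial>convpow q j)
      + ennreal (a powr (- s) * (s / a)) * (of_nat j * (\<integral>\<^sup>+z. of_nat z \<partial>q))"
    by (simp add: nn_integral_add nn_integral_cmult nn_integral_convpow_mean)
  also have "ennreal (a powr (- s) * (s / a)) * (of_nat j * (\<integral>\<^sup>+z. of_nat z \<partial>q))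
      = ennreal (a powr (- s) * s)"
    using a s m j unfolding m ennreal_of_nat_eq_real_of_nat
    by (simp add: ennreal_mult[symmetric] a_def)
  finally have *: "ennreal (a powr (- s) * (1 + s))
      \<le> (\<integral>\<^sup>+z. V s z \<partial>convpow q j) + ennreal (a powr (- s) * s)" .
  have "ennreal (a powr (- s)) = ennreal (a powr (- s) * (1 + s)) - ennreal (a powr (- s) * s)"
    using s by (subst ennreal_minus) (auto simp: algebra_simps)
  also have "\<dots> \<le> (\<integral>\<^sup>+z. V s z \<partial>convpow q j)"
    using ennreal_minus_mono[OF * order_refl, of "ennreal (a powr (- s) * s)"]
    by (simp add: ennreal_add_diff_cancel_right)
  also have "ennreal (a powr (- s)) = ennreal (m powr (- s)) * V s j"
    using m j by (simp add: a_def V_def ennreal_mult[symmetric] powr_mult mult.commute)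
  finally show ?thesis .
qed

text \<open>For \<open>a\<close> slightly below \<open>m\<close>, a sum of \<open>j\<close>
  offspring counts exceeds \<open>a j\<close> with probability near 1. On the rare remaining event
  the sum is still at least \<open>j\<close>, so \<open>V s\<close> is at most \<open>V s j\<close>
  there.\<close>

lemma convpow_V_upper:
  fixes q :: "nat pmf" and s e :: real
  assumes q0: "0 \<notin> set_pmf q" and summ: "summable (\<lambda>i. real i * pmf q i)"
    and m: "m = (\<Sum>i. real i * pmf q i)" "0 < m" and s: "0 < s" and e: "0 < e"
  shows "\<forall>\<^sub>F j in sequentially. (\<integral>\<^sup>+z. V s z \<partial>convpow q j) \<le> ennreal (m powr (- s) + e) * V s j"
proof -
  have "((\<lambda>a. a powr (- s)) \<longlongrightarrow> m powr (- s)) (at_left m)"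
    using m by (intro tendsto_intros) auto
  then have "\<forall>\<^sub>F a in at_left m. a powr (- s) < m powr (- s) + e / 2"
    using e by (intro order_tendstoD) auto
  moreover have "\<forall>\<^sub>F a in at_left m. 0 < a \<and> a < m"
    using m eventually_at_left_real by (auto simp: greaterThanLessThan_def)
  ultimately obtain a where a: "0 < a" "a < m" "a powr (- s) < m powr (- s) + e / 2"
    using eventually_happens[OF eventually_conj] trivial_limit_at_left_real by blast
  from convpow_lower_tail[OF summ] a m
  have "(\<lambda>j. measure (measure_pmf (convpow q j)) {z. real z \<le> a * real j}) \<longlonglongrightarrow> 0" by simp
  then have "\<forall>\<^sub>F j in sequentially.
      measure (measure_pmf (convpow q j)) {z. real z \<le> a * real j} < e / 2"
    using e by (intro order_tendstoD) auto
  with eventually_gt_at_top[of 0] show ?thesis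
  proof eventually_elim
    case (elim j)
    let ?A = "{z. real z \<le> a * real j}"
    have "(\<integral>\<^sup>+z. V s z \<partial>convpow q j)
        \<le> (\<integral>\<^sup>+z. ennreal ((a * real j) powr (- s)) + ennreal (real j powr (- s)) * indicator ?A z \<partial>convpow q j)"
    proof (intro nn_integral_mono_AE, unfold AE_measure_pmf_iff, intro ballI)
      fix z assume "z \<in> set_pmf (convpow q j)"
      then have "real j \<le> real z" using convpow_support[OF q0] by simp
      then have "real z powr (- s) \<le> real j powr (- s)"
        using elim s by (intro powr_mono2') auto
      moreover have "real z powr (- s) \<le> (a * real j) powr (- s)" if "z \<notin> ?A"
        using that elim s a by (intro powr_mono2') auto
      ultimately show "V s z \<le> ennreal ((a * real j) powr (- s)) + ennreal (real j powr (- s)) * indicator ?A z"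
        by (cases "z \<in> ?A") (auto simp: V_def intro!: add_increasing ennreal_leI)
    qed
    also have "\<dots> = ennreal ((a * real j) powr (- s) + real j powr (- s) * measure (measure_pmf (convpow q j)) ?A)"
      by (simp add: nn_integral_add nn_integral_cmult measure_pmf.emeasure_eq_measure ennreal_mult)
    also have "\<dots> = ennreal (a powr (- s) + measure (measure_pmf (convpow q j)) ?A) * V s j"
      using a by (simp add: V_def ennreal_mult[symmetric] powr_mult algebra_simps)
    also have "\<dots> \<le> ennreal (m powr (- s) + e) * V s j"
      using a elim by (intro mult_right_mono ennreal_leI) auto
    finally show ?case .
  qed
qed

context branching_env
begin

section \<open>Averaging one generation over the environment\<close>

lemma measurable_mean [measurable]: "mean p \<in> borel_measurable M"
  unfolding mean_def by measurable

definition good :: "'e \<Rightarrow> bool" where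
  "good xi \<longleftrightarrow> xi \<in> space M \<and> 1 \<le> mean p xi \<and> pmf (offspring p xi) 0 = 0
     \<and> summable (\<lambda>i. real i * pmf (offspring p xi) i)
     \<and> mean p xi = (\<Sum>i. real i * pmf (offspring p xi) i)"

text \<open>Without deaths \<open>p xi i \<le> i * p xi i\<close> for all \<open>i\<close>, hence
  the mean is at least 1. So \<open>ln (mean p xi)\<close> is nonnegative and \<open>mgf\<close> is
  finite on the nonpositive half-line.\<close>

lemma AE_good: "AE xi in M. good xi"
  using p0 mean_fin AE_space
proof eventually_elim
  case (elim xi)
  note sp = \<open>xi \<in> space M\<close>
  have "(\<Sum>i. p xi i) \<le> (\<Sum>i. real i * p xi i)"
  proof (rule suminf_le)
    show "p xi i \<le> real i * p xi i" for i
      using elim p_nonneg[OF sp, of i] by (cases i) (auto simp: algebra_simps)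
  qed (use p_sums[OF sp] elim in \<open>auto simp: sums_iff\<close>)
  then show ?case using p_sums[OF sp] elim
    by (simp add: good_def mean_def sums_iff pmf_offspring)
qed

lemma good_support: "good xi \<Longrightarrow> 0 \<notin> set_pmf (offspring p xi)"
  by (simp add: good_def set_pmf_iff)

lemma good_mean: "good xi \<Longrightarrow> (\<integral>\<^sup>+z. of_nat z \<partial>offspring p xi) = ennreal (mean p xi)"
  unfolding good_def nn_integral_measure_pmf nn_integral_count_space_nat ennreal_of_nat_eq_real_of_nat
  by (simp add: ennreal_mult[symmetric] mult.commute suminf_ennreal2)

definition mgf :: "real \<Rightarrow> real" where
  "mgf l = (\<integral>xi. exp (l * ln (mean p xi)) \<partial>M)"

lemma integrable_exp_nonpos: "l \<le> 0 \<Longrightarrow> integrable M (\<lambda>xi. exp (l * ln (mean p xi)))"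
proof (rule integrable_const_bound[where B = 1])
  assume "l \<le> 0"
  show "AE xi in M. norm (exp (l * ln (mean p xi))) \<le> 1"
    using AE_good
  proof eventually_elim
    case (elim xi)
    then have "0 \<le> ln (mean p xi)" by (simp add: good_def)
    then show ?case using \<open>l \<le> 0\<close> by (simp add: mult_nonpos_nonneg)
  qed
qed simp

lemma integral_pos:
  fixes f :: "'e \<Rightarrow> real"
  assumes "integrable M f" "AE xi in M. 0 < f xi"
  shows "0 < (\<integral>xi. f xi \<partial>M)"
proof -
  have "0 \<le> (\<integral>xi. f xi \<partial>M)"
    using assms(2) by (intro integral_nonneg_AE) (auto elim: eventually_mono)
  moreover have "(\<integral>xi. f xi \<partial>M) \<noteq> 0"
  proof
    assume "(\<integral>xi. f xi \<partial>M) = 0"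
    then have "AE xi in M. f xi = 0"
      using assms by (subst integral_nonneg_eq_0_iff_AE[symmetric]) (auto elim: eventually_mono)
    with assms(2) have "AE xi in M. False" by eventually_elim simp
    then show False by simp
  qed
  ultimately show ?thesis by simp
qed

lemma mgf_pos: "l \<le> 0 \<Longrightarrow> 0 < mgf l"
  unfolding mgf_def by (intro integral_pos integrable_exp_nonpos) auto

lemma nn_integral_mean_powr:
  assumes "0 \<le> s"
  shows "(\<integral>\<^sup>+xi. ennreal (mean p xi powr (- s)) \<partial>M) = ennreal (mgf (- s))"
proof -
  have "(\<integral>\<^sup>+xi. ennreal (mean p xi powr (- s)) \<partial>M)
      = (\<integral>\<^sup>+xi. ennreal (exp (- s * ln (mean p xi))) \<partial>M)"
    by (rule nn_integral_cong_AE, rule eventually_mono[OF AE_good]) (auto simp: good_def powr_def)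
  also have "\<dots> = ennreal (mgf (- s))"
    unfolding mgf_def using assms by (intro nn_integral_eq_integral integrable_exp_nonpos) auto
  finally show ?thesis .
qed

lemma Q_V_lower:
  assumes s: "0 < s"
  shows "ennreal (mgf (- s)) * V s j \<le> Q (V s) j"
proof (cases "j = 0")
  case False
  have "ennreal (mgf (- s)) * V s j = (\<integral>\<^sup>+xi. ennreal (mean p xi powr (- s)) * V s j \<partial>M)"
    using s by (simp add: nn_integral_multc nn_integral_mean_powr)
  also have "\<dots> \<le> Q (V s) j"
    unfolding Q_def
  proof (rule nn_integral_mono_AE, rule eventually_mono[OF AE_good])
    fix xi assume "good xi"
    then show "ennreal (mean p xi powr (- s)) * V s j \<le> (\<integral>\<^sup>+z. V s z \<partial>convpow (offspring p xi) j)"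
      using s False by (intro convpow_V_lower good_support good_mean) (auto simp: good_def)
  qed
  finally show ?thesis .
qed (simp add: V_def)

text \<open>The threshold in \<open>convpow_V_upper\<close> depends on the environment; dominated
  convergence of the quenched contraction factors gives one threshold for the average.\<close>

lemma Q_V_upper:
  assumes s: "0 < s" and e: "0 < e"
  shows "\<forall>\<^sub>F j in sequentially. Q (V s) j \<le> ennreal (mgf (- s) + e) * V s j"
proof -
  \<comment> \<open>\<open>u j xi\<close> is the quenched factor by which one generation from
    \<open>j\<close> multiplies \<open>V s j\<close>. Taking the maximum with its limiting upper
    bound in \<open>v\<close> turns a one-sided estimate into convergence.\<close>
  define u where "u = (\<lambda>j xi. enn2real (\<integral>\<^sup>+z. V s z \<partial>convpow (offspring p xi) j) * real j powr s)"
  define v where "v = (\<lambda>j xi. max (u j xi) (mean p xi powr (- s)))"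
  have u_meas [measurable]: "u j \<in> borel_measurable M" for j unfolding u_def by measurable
  have fin: "(\<integral>\<^sup>+z. V s z \<partial>convpow (offspring p xi) j) \<le> V s j" if "good xi" "0 < j" for xi j
  proof -
    have "(\<integral>\<^sup>+z. V s z \<partial>convpow (offspring p xi) j) \<le> (\<integral>\<^sup>+z. V s j \<partial>convpow (offspring p xi) j)"
    proof (intro nn_integral_mono_AE, unfold AE_measure_pmf_iff, intro ballI)
      fix z assume "z \<in> set_pmf (convpow (offspring p xi) j)"
      then have "j \<le> z" by (rule convpow_support[OF good_support[OF that(1)]])
      then show "V s z \<le> V s j"
        using that s unfolding V_def by (intro ennreal_leI powr_mono2') auto
    qed
    then show ?thesis by simp
  qed
  have u_eq: "(\<integral>\<^sup>+z. V s z \<partial>convpow (offspring p xi) j) = ennreal (u j xi) * V s j"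
    if "good xi" "0 < j" for xi j
  proof -
    have "(\<integral>\<^sup>+z. V s z \<partial>convpow (offspring p xi) j) < \<top>"
      using fin[OF that] by (rule order.strict_trans1) (simp add: V_def)
    then have "(\<integral>\<^sup>+z. V s z \<partial>convpow (offspring p xi) j)
        = ennreal (enn2real (\<integral>\<^sup>+z. V s z \<partial>convpow (offspring p xi) j) * (real j powr s * real j powr (- s)))"
      using that by (simp add: powr_add[symmetric])
    then show ?thesis
      unfolding u_def V_def by (simp add: ennreal_mult[symmetric] mult_ac)
  qed
  have u_le: "u j xi \<le> c" if "good xi" "0 < j" "0 \<le> c"
    "(\<integral>\<^sup>+z. V s z \<partial>convpow (offspring p xi) j) \<le> ennreal c * V s j" for j xi c
  proof -
    have "ennreal (u j xi) * V s j \<le> ennreal c * V s j"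
      using that(4) unfolding u_eq[OF that(1,2)] .
    then have "ennreal (u j xi * real j powr (- s)) \<le> ennreal (c * real j powr (- s))"
      using that by (simp add: V_def ennreal_mult u_def)
    then have "u j xi * real j powr (- s) \<le> c * real j powr (- s)"
      using that by (subst (asm) ennreal_le_iff) auto
    then show ?thesis using that by simp
  qed
  have u1: "u j xi \<le> 1" if "good xi" for j xi
    using u_le[OF that, of j 1] fin[OF that, of j] s by (cases "j = 0") (auto simp: u_def)
  have m1: "mean p xi powr (- s) \<le> 1" if "good xi" for xi
    using that s powr_mono2'[of "- s" 1 "mean p xi"] by (auto simp: good_def)
  have v1: "AE xi in M. norm (v j xi) \<le> 1" for j
    using AE_good
  proof eventually_elim
    case (elim xi)
    have "0 \<le> v j xi" by (simp add: v_def le_max_iff_disj)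
    moreover have "v j xi \<le> 1" using u1[OF elim] m1[OF elim] by (simp add: v_def)
    ultimately show ?case by simp
  qed
  have "(\<lambda>j. \<integral>xi. v j xi \<partial>M) \<longlonglongrightarrow> (\<integral>xi. mean p xi powr (- s) \<partial>M)"
  proof (rule integral_dominated_convergence[where w = "\<lambda>_. 1"])
    show "AE xi in M. norm (v j xi) \<le> 1" for j
      by (rule v1)
    show "AE xi in M. (\<lambda>j. v j xi) \<longlonglongrightarrow> mean p xi powr (- s)"
      using AE_good
    proof eventually_elim
      case (elim xi)
      show ?case
      proof (rule order_tendstoI)
        fix c assume "mean p xi powr (- s) < c"
        then obtain d where d: "mean p xi powr (- s) < d" "d < c" using dense by blast
        have "\<forall>\<^sub>F j in sequentially. (\<integral>\<^sup>+z. V s z \<partial>convpow (offspring p xi) j)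
           \<le> ennreal (mean p xi powr (- s) + (d - mean p xi powr (- s))) * V s j"
          by (rule convpow_V_upper[OF good_support]) (use elim s d in \<open>auto simp: good_def\<close>)
        then show "\<forall>\<^sub>F j in sequentially. v j xi < c"
          using eventually_gt_at_top[of 0]
        proof eventually_elim
          case (elim j)
          have "0 \<le> d" using d by (meson less_imp_le order_trans powr_ge_zero)
          then have "u j xi \<le> d" using elim \<open>good xi\<close> by (intro u_le) auto
          then show ?case using d by (auto simp: v_def)
        qed
      next
        fix c assume "c < mean p xi powr (- s)"
        then show "\<forall>\<^sub>F j in sequentially. c < v j xi" by (auto simp: v_def less_max_iff_disj)
      qed
    qed
  qed (auto simp: v_def)
  also have "(\<integral>xi. mean p xi powr (- s) \<partial>M) = mgf (- s)"
    unfolding mgf_def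
    by (rule integral_cong_AE) (auto intro!: eventually_mono[OF AE_good] simp: good_def powr_def)
  finally have "\<forall>\<^sub>F j in sequentially. (\<integral>xi. v j xi \<partial>M) < mgf (- s) + e"
    using e by (intro order_tendstoD) auto
  then show ?thesis using eventually_gt_at_top[of 0]
  proof eventually_elim
    case (elim j)
    have "Q (V s) j \<le> (\<integral>\<^sup>+xi. ennreal (v j xi) * V s j \<partial>M)"
      unfolding Q_def
      by (rule nn_integral_mono_AE, rule eventually_mono[OF AE_good])
        (use elim in \<open>auto simp: u_eq v_def intro!: mult_right_mono ennreal_leI\<close>)
    also have "\<dots> = ennreal (\<integral>xi. v j xi \<partial>M) * V s j"
      by (subst nn_integral_multc, simp add: v_def, subst nn_integral_eq_integral)
        (use v1 in \<open>auto simp: v_def le_max_iff_disj intro!: integrable_const_bound[where B = 1]\<close>)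
    also have "\<dots> \<le> ennreal (mgf (- s) + e) * V s j"
      using elim by (intro mult_right_mono ennreal_leI) auto
    finally show ?case .
  qed
qed

end

section \<open>Lyapunov function and Gaertner-Ellis bound\<close>

context branching_env
begin

section \<open>Cost of keeping the population size constant\<close>

lemma p_le_1: "xi \<in> space M \<Longrightarrow> p xi i \<le> 1"
  using pmf_le_1[of "offspring p xi" i] by (simp add: pmf_offspring)

lemma integrable_p_power: "integrable M (\<lambda>xi. p xi i ^ j)"
  by (rule integrable_const_bound[where B = 1])
    (auto intro!: AE_I2 power_le_one p_nonneg p_le_1 simp: p_nonneg)

lemma gam_nonneg: "0 \<le> gam M p j"
  unfolding gam_def by (intro integral_nonneg_AE AE_I2) (simp add: p_nonneg)

lemma gam_antimono: "i \<le> j \<Longrightarrow> gam M p j \<le> gam M p i"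
  unfolding gam_def
  by (intro integral_mono integrable_p_power power_decreasing p_nonneg p_le_1)

lemma nn_integral_pmf_diag:
  "(\<integral>\<^sup>+xi. ennreal (pmf (convpow (offspring p xi) j) j) \<partial>M) = ennreal (gam M p j)"
proof -
  have "(\<integral>\<^sup>+xi. ennreal (pmf (convpow (offspring p xi) j) j) \<partial>M) = (\<integral>\<^sup>+xi. ennreal (p xi 1 ^ j) \<partial>M)"
    by (rule nn_integral_cong_AE, rule eventually_mono[OF AE_good])
      (simp add: good_def pmf_convpow_diag pmf_offspring)
  also have "\<dots> = ennreal (gam M p j)"
    unfolding gam_def by (intro nn_integral_eq_integral integrable_p_power AE_I2) (simp add: p_nonneg)
  finally show ?thesis .
qed

lemma Q_stay: "ennreal (gam M p j) * f j \<le> Q f j"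
proof -
  have "ennreal (gam M p j) * f j = (\<integral>\<^sup>+xi. \<integral>\<^sup>+z. indicator {j} z * f j \<partial>convpow (offspring p xi) j \<partial>M)"
    by (simp add: nn_integral_multc emeasure_pmf_single nn_integral_pmf_diag)
  also have "\<dots> \<le> Q f j"
    unfolding Q_def by (intro nn_integral_mono) (auto simp: indicator_def)
  finally show ?thesis .
qed

lemma Qn_stay: "ennreal (gam M p k) ^ l * f k \<le> (Q ^^ l) f k"
proof (induction l)
  case (Suc l)
  have "ennreal (gam M p k) ^ Suc l * f k = ennreal (gam M p k) * (ennreal (gam M p k) ^ l * f k)"
    by (simp add: mult_ac)
  also have "\<dots> \<le> ennreal (gam M p k) * (Q ^^ l) f k" by (intro mult_left_mono Suc) simp
  also have "\<dots> \<le> (Q ^^ Suc l) f k" using Q_stay by simp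
  finally show ?case .
qed simp

text \<open>Restrict to the paths that remain at \<open>k\<close> for the first \<open>n - N\<close>
  generations, then let the chain run freely from \<open>k\<close> for \<open>N\<close>
  more.\<close>

lemma annP_stay:
  assumes "N \<le> n"
  shows "gam M p k ^ (n - N) * annP M p k N A \<le> annP M p k n A"
proof -
  have "ennreal (gam M p k ^ (n - N) * annP M p k N A)
      = ennreal (gam M p k) ^ (n - N) * (Q ^^ N) (indicator A) k"
    by (simp add: ennreal_mult annP_nonneg gam_nonneg ennreal_power annP_eq)
  also have "\<dots> \<le> (Q ^^ (n - N)) ((Q ^^ N) (indicator A)) k" by (rule Qn_stay)
  also have "\<dots> = (Q ^^ (n - N + N)) (indicator A) k" by (simp only: funpow_add o_apply)
  also have "\<dots> = ennreal (annP M p k n A)" using assms by (simp add: annP_eq)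
  finally show ?thesis by (simp add: annP_nonneg)
qed

text \<open>Far from the origin \<open>V s\<close> contracts by almost \<open>mgf (- s)\<close>. Near the origin the chain moves up
  or stays put, the latter with probability at most \<open>gam M p k\<close>, so a function that drops
  steeply from each state to the next contracts there. States below \<open>k\<close> are never visited and get
  the value \<open>\<top>\<close>.\<close>
lemma Lyapunov_function:
  assumes s: "0 < s" and k: "1 \<le> k" and rho: "gam M p k < rho" "mgf (- s) < rho"
  obtains W C where "\<And>z. V s z \<le> W z" "W 0 = \<top>" "0 \<le> C"
    "\<And>n. (Q ^^ n) W k \<le> ennreal (C * rho ^ n)"
proof -
  have rho0: "0 < rho" using gam_nonneg rho by (meson le_less_trans)
  obtain K where K: "\<And>j. K \<le> j \<Longrightarrow> Q (V s) j \<le> ennreal rho * V s j"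
    using Q_V_upper[OF s, of "rho - mgf (- s)"] rho by (auto simp: eventually_sequentially)
  \<comment> \<open>Large enough that \<open>B * gam M p k + 1 \<le> rho * B\<close>: staying keeps
    the weight, while any move up loses at least one factor \<open>B\<close>.\<close>
  define B where "B = max 1 (1 / (rho - gam M p k))"
  have B: "1 \<le> B" by (simp add: B_def)
  have "1 \<le> (rho - gam M p k) * B"
    using rho mult_left_mono[of "1 / (rho - gam M p k)" B "rho - gam M p k"] by (simp add: B_def)
  then have B': "B * gam M p k + 1 \<le> rho * B" by (simp add: algebra_simps)
  define W where "W = (\<lambda>z. if z < k then \<top> else if z < K then ennreal (B ^ (K - z)) else V s z)"
  have V1: "V s z \<le> 1" if "0 < z" for z
    using that s powr_mono2'[of "- s" 1 "real z"] by (simp add: V_def)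
  have VW: "V s z \<le> W z" for z
  proof (cases "k \<le> z \<and> z < K")
    case True
    then have "V s z \<le> 1" using k by (intro V1) auto
    also have "\<dots> \<le> ennreal (B ^ (K - z))" using B by simp
    finally show ?thesis using True by (simp add: W_def)
  qed (auto simp: W_def)
  have QW: "Q W j \<le> ennreal rho * W j" for j
  proof -
    consider "j < k" | "k \<le> j" "K \<le> j" | "k \<le> j" "j < K" by linarith
    then show ?thesis
    proof cases
      case 1
      then show ?thesis using rho0 by (simp add: W_def ennreal_mult_top)
    next
      case 2
      \<comment> \<open>From \<open>j\<close> the chain only reaches states where \<open>W\<close>
        and \<open>V s\<close> coincide.\<close>
      have "Q W j \<le> Q (V s) j"
        unfolding Q_def
      proof (intro nn_integral_mono_AE, rule eventually_mono[OF AE_good])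
        fix xi assume "good xi"
        then show "(\<integral>\<^sup>+z. W z \<partial>convpow (offspring p xi) j) \<le> (\<integral>\<^sup>+z. V s z \<partial>convpow (offspring p xi) j)"
          using 2 by (intro nn_integral_mono_AE)
            (fastforce simp: AE_measure_pmf_iff W_def dest: convpow_support[OF good_support])
      qed
      then show ?thesis using K[OF 2(2)] 2 by (simp add: W_def)
    next
      case 3
      note jK = this
      \<comment> \<open>\<open>W j = B ^ Suc m\<close>, whereas every state above \<open>j\<close>
        has weight at most \<open>B ^ m\<close>.\<close>
      define m where "m = K - Suc j"
      have m: "K - j = Suc m" using 3 by (simp add: m_def)
      have "Q W j \<le> (\<integral>\<^sup>+xi. ennreal (pmf (convpow (offspring p xi) j) j) * ennreal (B ^ Suc m)
          + ennreal (B ^ m) \<partial>M)"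
        unfolding Q_def
      proof (intro nn_integral_mono_AE, rule eventually_mono[OF AE_good])
        fix xi assume good: "good xi"
        have "(\<integral>\<^sup>+z. W z \<partial>convpow (offspring p xi) j)
            \<le> (\<integral>\<^sup>+z. indicator {j} z * ennreal (B ^ Suc m) + ennreal (B ^ m) \<partial>convpow (offspring p xi) j)"
        proof (intro nn_integral_mono_AE, unfold AE_measure_pmf_iff, intro ballI)
          fix z assume "z \<in> set_pmf (convpow (offspring p xi) j)"
          then have z: "j \<le> z" by (rule convpow_support[OF good_support[OF good]])
          consider "z = j" | "j < z" "z < K" | "j < z" "K \<le> z" using z by linarith
          then show "W z \<le> indicator {j} z * ennreal (B ^ Suc m) + ennreal (B ^ m)"
          proof cases
            case 1
            then show ?thesis using jK m by (simp add: W_def)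
          next
            case 2
            then have "B ^ (K - z) \<le> B ^ m" using B by (intro power_increasing) (auto simp: m_def)
            then show ?thesis using 2 jK by (simp add: W_def ennreal_leI)
          next
            case 3
            then have "V s z \<le> 1" by (intro V1) simp
            also have "1 \<le> ennreal (B ^ m)" using B by simp
            finally show ?thesis using jK 3 by (simp add: W_def)
          qed
        qed
        then show "(\<integral>\<^sup>+z. W z \<partial>convpow (offspring p xi) j)
            \<le> ennreal (pmf (convpow (offspring p xi) j) j) * ennreal (B ^ Suc m) + ennreal (B ^ m)"
          by (simp add: nn_integral_add nn_integral_multc emeasure_pmf_single del: power_Suc)
      qed
      also have "\<dots> = ennreal (gam M p j * B ^ Suc m + B ^ m)"
        using B gam_nonneg[of j]
        by (simp add: nn_integral_add nn_integral_multc nn_integral_pmf_diag emeasure_space_1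
            ennreal_mult del: power_Suc)
      also have "\<dots> \<le> ennreal (rho * B ^ Suc m)"
      proof (rule ennreal_leI)
        have "gam M p j * B ^ Suc m + B ^ m \<le> gam M p k * B ^ Suc m + B ^ m"
          using B 3 by (intro add_mono mult_right_mono gam_antimono) auto
        also have "\<dots> = B ^ m * (B * gam M p k + 1)" by (simp add: algebra_simps)
        also have "\<dots> \<le> B ^ m * (rho * B)" using B B' by (intro mult_left_mono) auto
        finally show "gam M p j * B ^ Suc m + B ^ m \<le> rho * B ^ Suc m" by (simp add: mult_ac)
      qed
      also have "\<dots> = ennreal rho * W j"
        using 3 rho0 B m by (simp add: W_def ennreal_mult)
      finally show ?thesis .
    qed
  qed
  define C where "C = enn2real (W k)"
  have Wk: "W k = ennreal C" by (simp add: C_def W_def V_def)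
  have C: "0 \<le> C" by (simp add: C_def)
  have "(Q ^^ n) W k \<le> ennreal (C * rho ^ n)" for n
    using Qn_upper[of W "ennreal rho" n k, OF QW] rho0 C
    by (simp add: Wk ennreal_power ennreal_mult mult.commute)
  moreover have "W 0 = \<top>" using k by (simp add: W_def)
  ultimately show ?thesis using VW C that by blast
qed

text \<open>Domination by the Lyapunov function. For \<open>s\<close> below \<open>r\<close> any
  \<open>rho\<close> above \<open>mgf (- s)\<close> qualifies, so with \<open>Q_V_lower\<close> the
  growth rate is identified.\<close>

lemma harmonic_moment_upper:
  assumes "0 < s" "1 \<le> k" "gam M p k < rho" "mgf (- s) < rho"
  obtains C where "0 \<le> C" "\<And>n. (Q ^^ n) (V s) k \<le> ennreal (C * rho ^ n)"
  using Lyapunov_function[OF assms] Qn_mono order_trans by metis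

text \<open>Markov's inequality, applied to \<open>W\<close> and not to \<open>V s\<close>, because
  \<open>W 0 = \<top>\<close> also covers state 0.\<close>

lemma annP_upper:
  assumes s: "0 < s" and "1 \<le> k" "gam M p k < rho" "mgf (- s) < rho"
  obtains C where "0 \<le> C" "\<And>n x. 0 < x \<Longrightarrow> annP M p k n {z. real z \<le> x} \<le> C * rho ^ n * x powr s"
proof -
  obtain W C where W: "\<And>z. V s z \<le> W z" "W 0 = \<top>" "0 \<le> C"
    "\<And>n. (Q ^^ n) W k \<le> ennreal (C * rho ^ n)"
    using Lyapunov_function[OF assms] by metis
  have rho0: "0 < rho" using gam_nonneg assms by (meson le_less_trans)
  have "annP M p k n {z. real z \<le> x} \<le> C * rho ^ n * x powr s" if x: "0 < x" for n x
  proof -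
    have "indicator {z. real z \<le> x} z \<le> ennreal (x powr s) * W z" for z
    proof (cases "z = 0")
      case False
      have "1 \<le> ennreal (x powr s) * V s z" if "real z \<le> x"
      proof -
        have "x powr (- s) \<le> real z powr (- s)" using that False s by (intro powr_mono2') auto
        then have "x powr s * x powr (- s) \<le> x powr s * real z powr (- s)" by (intro mult_left_mono) auto
        then show ?thesis using x by (simp add: V_def ennreal_mult[symmetric] powr_add[symmetric])
      qed
      also have "ennreal (x powr s) * V s z \<le> ennreal (x powr s) * W z" by (intro mult_left_mono W) simp
      finally show ?thesis by (auto simp: indicator_def)
    qed (use W x in \<open>simp add: ennreal_mult_top\<close>)
    then have "ennreal (annP M p k n {z. real z \<le> x}) \<le> (Q ^^ n) (\<lambda>z. ennreal (x powr s) * W z) k"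
      unfolding annP_eq by (rule Qn_mono)
    also have "\<dots> \<le> ennreal (x powr s) * ennreal (C * rho ^ n)"
      unfolding Qn_cmult by (intro mult_left_mono W) simp
    also have "\<dots> = ennreal (C * rho ^ n * x powr s)"
      using W rho0 by (simp add: ennreal_mult[symmetric] mult_ac)
    finally show ?thesis using W rho0 by (subst (asm) ennreal_le_iff) auto
  qed
  then show ?thesis using that W by blast
qed

lemma LLambda_eq: "LLambda M p l = ln (mgf l)"
  by (simp add: LLambda_def mgf_def)

text \<open>The Gaertner-Ellis argument for \<open>log Z\<close>: under the measure weighted by \<open>Z powr (- s)\<close>, the
  harmonic moments of orders \<open>s - h\<close> and \<open>s + h\<close> confine \<open>log Z\<close> to a window around \<open>y N\<close>.\<close>
lemma annP_lower:
  assumes k: "1 \<le> k" and s: "0 < s" "s < r"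
    and gam: "\<And>s. 0 < s \<Longrightarrow> s < r \<Longrightarrow> gam M p k < mgf (- s)"
    and der: "(LLambda M p has_real_derivative y) (at (- s))" and d: "0 < d"
  shows "\<forall>\<^sub>F N in sequentially. exp (real N * (s * (y - d) + LLambda M p (- s) - d))
    \<le> annP M p k N {z. real z \<le> exp ((y + d) * real N)}"
proof -
  let ?L = "LLambda M p"
  have "(\<lambda>h. (?L (- s + h) - ?L (- s)) / h) \<midarrow>0\<rightarrow> y"
    using der by (simp add: DERIV_def)
  then have "\<forall>\<^sub>F h in at 0. dist ((?L (- s + h) - ?L (- s)) / h) y < d / 2"
    using d by (intro tendstoD) auto
  then obtain e where e: "0 < e"
    "\<And>h. h \<noteq> 0 \<Longrightarrow> \<bar>h\<bar> < e \<Longrightarrow> \<bar>(?L (- s + h) - ?L (- s)) / h - y\<bar> < d / 2"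
    by (auto simp: eventually_at dist_real_def)
  \<comment> \<open>Keeps both orders \<open>s - h\<close> and \<open>s + h\<close> strictly between
    0 and \<open>r\<close> and the difference quotients within \<open>d / 2\<close> of
    \<open>y\<close>.\<close>
  define h where "h = min e (min s (r - s)) / 2"
  have h: "0 < h" "h < e" "h < s" "h < r - s" using e s by (auto simp: h_def)
  have L1: "?L (- (s + h)) < ?L (- s) - h * y + h * d / 2"
  proof -
    define q where "q = (?L (- s + - h) - ?L (- s)) / - h"
    have "y - d / 2 < q" using e(2)[of "- h"] h unfolding q_def[symmetric] by linarith
    then have "h * (y - d / 2) < h * q" using h by simp
    moreover have "h * q = ?L (- s) - ?L (- (s + h))" using h by (simp add: q_def)
    ultimately show ?thesis by (simp add: right_diff_distrib)
  qed
  have L2: "?L (- (s - h)) < ?L (- s) + h * y + h * d / 2"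
  proof -
    define q where "q = (?L (- s + h) - ?L (- s)) / h"
    have "q < y + d / 2" using e(2)[of h] h unfolding q_def[symmetric] by linarith
    then have "h * q < h * (y + d / 2)" using h by simp
    moreover have "h * q = ?L (- (s - h)) - ?L (- s)" using h by (simp add: q_def)
    ultimately show ?thesis by (simp add: distrib_left)
  qed
  define r1 where "r1 = exp (?L (- s) - h * y + h * d / 2)"
  define r2 where "r2 = exp (?L (- s) + h * y + h * d / 2)"
  have mgf_exp: "mgf l = exp (?L l)" if "l \<le> 0" for l
    using mgf_pos[OF that] by (simp add: LLambda_eq)
  have "mgf (- (s + h)) < r1" "mgf (- (s - h)) < r2"
    using L1 L2 h s by (simp_all only: r1_def r2_def mgf_exp exp_less_cancel_iff)
  moreover have "gam M p k < r1" "gam M p k < r2"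
    using gam[of "s + h"] gam[of "s - h"] h s calculation by auto
  ultimately obtain C1 C2 where C: "0 \<le> C1" "0 \<le> C2"
    "\<And>n. (Q ^^ n) (V (s + h)) k \<le> ennreal (C1 * r1 ^ n)"
    "\<And>n. (Q ^^ n) (V (s - h)) k \<le> ennreal (C2 * r2 ^ n)"
    using harmonic_moment_upper[of "s + h" k r1] harmonic_moment_upper[of "s - h" k r2] h s k
    by (smt (verit) add_pos_pos)
  define c where "c = real k powr (- s)"
  have c: "0 < c" using k by (simp add: c_def)
  have main: "exp (real N * (s * (y - d) + ?L (- s))) * (c - (C1 + C2) * exp (- (h * d / 2) * real N))
      \<le> annP M p k N {z. real z \<le> exp ((y + d) * real N)}" for N
  proof -
    let ?A = "{z. real z \<le> exp ((y + d) * real N)}"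
    \<comment> \<open>Below the window \<open>z powr (- s)\<close> is \<open>z powr h\<close> times
      \<open>V (s + h)\<close>, above it \<open>z powr (- h)\<close> times \<open>V (s - h)\<close>;
      \<open>b1\<close> and \<open>b2\<close> bound these factors, and \<open>b0\<close> bounds
      \<open>z powr (- s)\<close> inside.\<close>
    define b0 where "b0 = exp (- s * (y - d) * real N)"
    define b1 where "b1 = exp (h * (y - d) * real N)"
    define b2 where "b2 = exp (- h * (y + d) * real N)"
    have pw: "V s z \<le> ennreal b0 * indicator ?A z + (ennreal b1 * V (s + h) z + ennreal b2 * V (s - h) z)" for z
    proof (cases "z = 0")
      case False
      then have z: "0 < real z" by simp
      consider "real z \<le> exp ((y - d) * real N)" | "exp ((y + d) * real N) < real z"
        | "exp ((y - d) * real N) < real z" "real z \<le> exp ((y + d) * real N)" by linarith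
      then show ?thesis
      proof cases
        case 1
        then have "ln (real z) \<le> (y - d) * real N" using z ln_mono[of "real z" "exp ((y - d) * real N)"] by simp
        then have "h * ln (real z) \<le> h * ((y - d) * real N)" using h by (intro mult_left_mono) auto
        then have "real z powr (- s) \<le> b1 * real z powr (- (s + h))"
          using z by (simp add: b1_def powr_def exp_add[symmetric] algebra_simps)
        then have "V s z \<le> ennreal b1 * V (s + h) z"
          by (simp add: V_def ennreal_mult[symmetric] b1_def ennreal_leI)
        then show ?thesis by (meson add_increasing add_increasing2 order_trans zero_le)
      next
        case 2
        then have "(y + d) * real N \<le> ln (real z)" using z by (simp add: ln_ge_iff)
        then have "h * ((y + d) * real N) \<le> h * ln (real z)" using h by (intro mult_left_mono) auto
        then have "real z powr (- s) \<le> b2 * real z powr (- (s - h))"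
          using z by (simp add: b2_def powr_def exp_add[symmetric] algebra_simps)
        then have "V s z \<le> ennreal b2 * V (s - h) z"
          by (simp add: V_def ennreal_mult[symmetric] b2_def ennreal_leI)
        then show ?thesis by (meson add_increasing add_increasing2 order_trans zero_le)
      next
        case 3
        then have "(y - d) * real N \<le> ln (real z)" using z by (simp add: ln_ge_iff)
        then have "s * ((y - d) * real N) \<le> s * ln (real z)" using s by (intro mult_left_mono) auto
        then have "real z powr (- s) \<le> b0"
          using z by (simp add: b0_def powr_def algebra_simps)
        then have "V s z \<le> ennreal b0 * indicator ?A z"
          using 3 by (simp add: V_def ennreal_leI)
        then show ?thesis by (meson add_increasing add_increasing2 order_trans zero_le)
      qed
    qed (simp add: V_def)
    have "ennreal (mgf (- s)) ^ N * V s k \<le> (Q ^^ N) (V s) k"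
      by (intro Qn_lower Q_V_lower s)
    also have "\<dots> \<le> ennreal b0 * (Q ^^ N) (indicator ?A) k
        + (ennreal b1 * (Q ^^ N) (V (s + h)) k + ennreal b2 * (Q ^^ N) (V (s - h)) k)"
      unfolding Qn_cmult[symmetric] Qn_add[symmetric] by (rule Qn_mono, rule pw)
    also have "\<dots> \<le> ennreal b0 * ennreal (annP M p k N ?A)
        + (ennreal b1 * ennreal (C1 * r1 ^ N) + ennreal b2 * ennreal (C2 * r2 ^ N))"
      unfolding annP_eq by (intro add_mono mult_left_mono C) auto
    also have "\<dots> = ennreal (b0 * annP M p k N ?A + (b1 * (C1 * r1 ^ N) + b2 * (C2 * r2 ^ N)))"
      using C by (simp add: b0_def b1_def b2_def r1_def r2_def annP_nonneg ennreal_mult)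
    also have "ennreal (mgf (- s)) ^ N * V s k = ennreal (mgf (- s) ^ N * c)"
      using mgf_pos[of "- s"] s by (simp add: V_def c_def ennreal_power ennreal_mult)
    finally have le: "mgf (- s) ^ N * c \<le> b0 * annP M p k N ?A + (b1 * (C1 * r1 ^ N) + b2 * (C2 * r2 ^ N))"
      using C by (subst (asm) ennreal_le_iff)
        (auto simp: b0_def b1_def b2_def r1_def r2_def annP_nonneg intro!: add_nonneg_nonneg)
    have e0: "mgf (- s) ^ N = exp (real N * ?L (- s))"
      using mgf_pos[of "- s"] s by (simp add: LLambda_eq exp_of_nat_mult)
    \<comment> \<open>The window gains \<open>h d\<close> in the exponent and the difference
      quotients lose only \<open>h d / 2\<close>, so both error terms are exponentially smaller than
      the main term.\<close>
    have e1: "b1 * r1 ^ N = exp (real N * ?L (- s)) * exp (- (h * d / 2) * real N)"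
      by (simp add: b1_def r1_def exp_of_nat_mult[symmetric] exp_add[symmetric] field_simps)
    have e2: "b2 * r2 ^ N = exp (real N * ?L (- s)) * exp (- (h * d / 2) * real N)"
      by (simp add: b2_def r2_def exp_of_nat_mult[symmetric] exp_add[symmetric] field_simps)
    have "exp (real N * ?L (- s)) * (c - (C1 + C2) * exp (- (h * d / 2) * real N))
        = mgf (- s) ^ N * c - (C1 * (b1 * r1 ^ N) + C2 * (b2 * r2 ^ N))"
      unfolding e0 e1 e2 by (simp add: algebra_simps)
    also have "\<dots> \<le> b0 * annP M p k N ?A" using le by (simp add: algebra_simps)
    finally have "exp (s * (y - d) * real N) * (exp (real N * ?L (- s)) * (c - (C1 + C2) * exp (- (h * d / 2) * real N)))
        \<le> exp (s * (y - d) * real N) * (b0 * annP M p k N ?A)"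
      by (intro mult_left_mono) auto
    also have "\<dots> = annP M p k N ?A"
      by (simp add: b0_def mult.assoc[symmetric] exp_add[symmetric])
    finally show ?thesis
      by (simp add: mult.assoc[symmetric] exp_add[symmetric]) (simp add: algebra_simps)
  qed
  have "(\<lambda>N. exp (- x * real N)) \<longlonglongrightarrow> 0" if "0 < x" for x :: real
  proof -
    have "exp (- x * real N) = exp (- x) ^ N" for N by (simp add: exp_of_nat_mult[symmetric] mult.commute)
    then show ?thesis using that by (simp add: LIMSEQ_power_zero)
  qed
  from this[of "h * d / 2"] this[of d]
  \<comment> \<open>The extra \<open>- d\<close> in the claimed exponent absorbs the constant
    \<open>c\<close> and the error terms for large \<open>N\<close>.\<close>
  have "(\<lambda>N. c - (C1 + C2) * exp (- (h * d / 2) * real N) - exp (- d * real N)) \<longlonglongrightarrow> c - (C1 + C2) * 0 - 0"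
    using h d by (intro tendsto_intros) auto
  then have "\<forall>\<^sub>F N in sequentially. 0 < c - (C1 + C2) * exp (- (h * d / 2) * real N) - exp (- d * real N)"
    using c by (intro order_tendstoD) auto
  then show ?thesis
  proof eventually_elim
    case (elim N)
    have "exp (real N * (s * (y - d) + ?L (- s) - d))
        = exp (real N * (s * (y - d) + ?L (- s))) * exp (- d * real N)"
      by (simp add: exp_add[symmetric] algebra_simps)
    also have "\<dots> \<le> exp (real N * (s * (y - d) + ?L (- s))) * (c - (C1 + C2) * exp (- (h * d / 2) * real N))"
      using elim by (intro mult_left_mono) auto
    also note main
    finally show ?case .
  qed
qed

end

section \<open>The log-Laplace transform\<close>

text \<open>Supplies the dominating function for differentiating \<open>mgf\<close> under the
  integral.\<close>

lemma abs_exp_minus_one_le: "\<bar>exp x - 1\<bar> \<le> \<bar>x\<bar> * exp \<bar>x\<bar>" for x :: real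
proof (cases "0 \<le> x")
  case True
  have "(1 - x) * exp x \<le> exp (- x) * exp x"
    using exp_ge_add_one_self[of "- x"] by (intro mult_right_mono) auto
  then show ?thesis using True by (simp add: exp_add[symmetric] algebra_simps)
next
  case False
  then have "exp x \<le> 1" by simp
  then have "\<bar>exp x - 1\<bar> \<le> \<bar>x\<bar> * 1" using exp_ge_add_one_self[of x] by linarith
  also have "\<dots> \<le> \<bar>x\<bar> * exp \<bar>x\<bar>" by (intro mult_left_mono) auto
  finally show ?thesis .
qed

context branching_env
begin

abbreviation X :: "'e \<Rightarrow> real" where
  "X xi \<equiv> ln (mean p xi)"

section \<open>Differentiability of the moment generating function\<close>

lemma AE_X_nonneg: "AE xi in M. 0 \<le> X xi"
  using AE_good by (rule eventually_mono) (simp add: good_def)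

lemma integrable_exp_mono:
  assumes "integrable M (\<lambda>xi. exp (u * X xi))" "l \<le> u"
  shows "integrable M (\<lambda>xi. exp (l * X xi))"
  by (rule Bochner_Integration.integrable_bound[OF assms(1)])
    (use AE_X_nonneg assms(2) in \<open>auto intro: mult_right_mono elim: eventually_mono\<close>)

lemma
  assumes u: "integrable M (\<lambda>xi. exp (u * X xi))" and l: "l < u"
  shows integrable_X_exp: "integrable M (\<lambda>xi. X xi * exp (l * X xi))"
    and DERIV_mgf: "(mgf has_real_derivative (\<integral>xi. X xi * exp (l * X xi) \<partial>M)) (at l)"
proof -
  \<comment> \<open>The gap between \<open>l\<close> and \<open>u\<close> is spent in two halves:
    one absorbs the factor \<open>X\<close>, the other the increment of the exponent.\<close>
  define d where "d = (u - l) / 2"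
  have d: "0 < d" "u = l + d + d" using l by (auto simp: d_def field_simps)
  have lin: "x \<le> exp (d * x) / d" for x :: real
  proof -
    have "d * x \<le> exp (d * x)" using exp_ge_add_one_self[of "d * x"] by linarith
    then show ?thesis using d(1) by (simp add: pos_le_divide_eq mult.commute)
  qed
  show "integrable M (\<lambda>xi. X xi * exp (l * X xi))"
  proof (rule Bochner_Integration.integrable_bound)
    show "integrable M (\<lambda>xi. 1 / d * exp (u * X xi))" using u by simp
    show "AE xi in M. norm (X xi * exp (l * X xi)) \<le> norm (1 / d * exp (u * X xi))"
      using AE_X_nonneg
    proof eventually_elim
      case (elim xi)
      have "X xi * exp (l * X xi) \<le> exp (d * X xi) / d * exp (l * X xi)"
        by (intro mult_right_mono lin) simp
      also have "\<dots> = 1 / d * exp ((l + d) * X xi)" by (simp add: exp_add[symmetric] algebra_simps)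
      also have "\<dots> \<le> 1 / d * exp (u * X xi)"
        using d elim by (intro mult_left_mono) (auto intro!: mult_right_mono)
      finally show ?case using elim d by simp
    qed
  qed simp
  show "(mgf has_real_derivative (\<integral>xi. X xi * exp (l * X xi) \<partial>M)) (at l)"
    unfolding DERIV_def LIMSEQ_SEQ_conv[symmetric]
  proof (intro allI impI, elim conjE)
    fix S :: "nat \<Rightarrow> real" assume S0: "\<forall>n. S n \<noteq> 0" and S: "S \<longlonglongrightarrow> 0"
    have "\<forall>\<^sub>F n in sequentially. dist (S n) 0 < d" using S d by (intro tendstoD) auto
    \<comment> \<open>Dominated convergence needs the bound for every index, so an initial segment
      of the sequence is dropped.\<close>
    then obtain N where "\<forall>n\<ge>N. \<bar>S n\<bar> < d"
      by (auto simp: eventually_sequentially)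
    then have N: "\<bar>S (n + N)\<bar> < d" for n by simp
    define g where "g = (\<lambda>n xi. (exp ((l + S (n + N)) * X xi) - exp (l * X xi)) / S (n + N))"
    have int: "integrable M (\<lambda>xi. exp ((l + S (n + N)) * X xi))" "integrable M (\<lambda>xi. exp (l * X xi))" for n
      using N[of n] d by (auto intro!: integrable_exp_mono[OF u])
    have "(\<lambda>n. \<integral>xi. g n xi \<partial>M) \<longlonglongrightarrow> (\<integral>xi. X xi * exp (l * X xi) \<partial>M)"
    proof (rule integral_dominated_convergence[where w = "\<lambda>xi. 1 / d * exp (u * X xi)"])
      show "integrable M (\<lambda>xi. 1 / d * exp (u * X xi))" using u by simp
      show "AE xi in M. norm (g n xi) \<le> 1 / d * exp (u * X xi)" for n
        using AE_X_nonneg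
      proof eventually_elim
        case (elim xi)
        let ?h = "S (n + N)" and ?x = "X xi"
        have "norm (g n xi) = exp (l * ?x) * \<bar>exp (?h * ?x) - 1\<bar> / \<bar>?h\<bar>"
        proof -
          have "exp ((l + ?h) * ?x) - exp (l * ?x) = exp (l * ?x) * (exp (?h * ?x) - 1)"
            by (simp add: exp_add distrib_right right_diff_distrib)
          then show ?thesis by (simp add: g_def abs_mult)
        qed
        also have "\<dots> \<le> exp (l * ?x) * (\<bar>?h * ?x\<bar> * exp \<bar>?h * ?x\<bar>) / \<bar>?h\<bar>"
          by (intro divide_right_mono mult_left_mono abs_exp_minus_one_le) auto
        also have "\<dots> = exp (l * ?x) * ?x * exp (\<bar>?h\<bar> * ?x)"
          using S0 elim by (simp add: abs_mult)
        also have "\<dots> \<le> exp (l * ?x) * (exp (d * ?x) / d) * exp (d * ?x)"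
        proof (intro mult_mono lin order_refl)
          have "\<bar>?h\<bar> * ?x \<le> d * ?x" using N[of n] elim by (intro mult_right_mono) auto
          then show "exp (\<bar>?h\<bar> * ?x) \<le> exp (d * ?x)" by simp
        qed (use d(1) elim in auto)
        also have "\<dots> = 1 / d * exp (u * ?x)" by (simp add: d(2) exp_add[symmetric] algebra_simps)
        finally show ?case .
      qed
      show "AE xi in M. (\<lambda>n. g n xi) \<longlonglongrightarrow> X xi * exp (l * X xi)"
      proof (rule AE_I2)
        fix xi
        have "((\<lambda>l. exp (l * X xi)) has_real_derivative X xi * exp (l * X xi)) (at l)"
          by (auto intro!: derivative_eq_intros)
        then have "(\<lambda>n. (exp ((l + S n) * X xi) - exp (l * X xi)) / S n) \<longlonglongrightarrow> X xi * exp (l * X xi)"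
          unfolding DERIV_def LIMSEQ_SEQ_conv[symmetric] using S0 S by blast
        then show "(\<lambda>n. g n xi) \<longlonglongrightarrow> X xi * exp (l * X xi)"
          unfolding g_def by (rule LIMSEQ_ignore_initial_segment)
      qed
    qed (auto simp: g_def)
    also have "(\<lambda>n. \<integral>xi. g n xi \<partial>M) = (\<lambda>n. (mgf (l + S (n + N)) - mgf l) / S (n + N))"
      using int by (simp add: g_def mgf_def)
    finally show "(\<lambda>n. (mgf (l + S n) - mgf l) / S n) \<longlonglongrightarrow> (\<integral>xi. X xi * exp (l * X xi) \<partial>M)"
      by (rule LIMSEQ_offset)
  qed
qed

text \<open>The mean of \<open>X\<close> under the exponentially tilted environment law, which is
  the derivative of \<open>LLambda\<close>.\<close>

definition tilt :: "real \<Rightarrow> real" where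
  "tilt l = (\<integral>xi. X xi * exp (l * X xi) \<partial>M) / mgf l"

lemma mgf_0: "mgf 0 = 1"
  by (simp add: mgf_def prob_space)

lemma LLambda_0: "LLambda M p 0 = 0"
  by (simp add: LLambda_eq mgf_0)

lemma tilt_0: "tilt 0 = (\<integral>xi. X xi \<partial>M)"
  by (simp add: tilt_def mgf_0)

lemma mgf_eq_exp: "l \<le> 0 \<Longrightarrow> mgf l = exp (LLambda M p l)"
  using mgf_pos[of l] by (simp add: LLambda_eq)

end

text \<open>A positive exponential moment makes \<open>LLambda\<close> differentiable on the whole
  closed half-line, including at 0.\<close>

locale branching_env_moment = branching_env +
  fixes u :: real
  assumes u_pos: "0 < u" and u_moment: "integrable M (\<lambda>xi. exp (u * X xi))"
begin

lemma DERIV_LLambda: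
  assumes "l \<le> 0"
  shows "(LLambda M p has_real_derivative tilt l) (at l)"
  unfolding LLambda_eq[abs_def] tilt_def
  using DERIV_ln_divide[THEN DERIV_chain2, OF mgf_pos[OF assms] DERIV_mgf[OF u_moment, of l]] u_pos assms
  by simp

text \<open>Convexity of \<open>LLambda\<close>: integrate the tangent of the exponential function at \<open>(l' - l) * tilt l\<close>.\<close>
lemma LLambda_tangent:
  assumes "l \<le> 0" "l' \<le> 0"
  shows "LLambda M p l + tilt l * (l' - l) \<le> LLambda M p l'"
proof -
  define a where "a = (l' - l) * tilt l"
  have int: "integrable M (\<lambda>xi. exp (l * X xi))" "integrable M (\<lambda>xi. exp (l' * X xi))"
    "integrable M (\<lambda>xi. X xi * exp (l * X xi))"
    using assms u_pos integrable_exp_nonpos integrable_X_exp[OF u_moment, of l] by auto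
  have "exp a * mgf l = exp a * ((1 - a) * mgf l + (l' - l) * (\<integral>xi. X xi * exp (l * X xi) \<partial>M))"
  proof -
    have "(l' - l) * (\<integral>xi. X xi * exp (l * X xi) \<partial>M) = a * mgf l"
      using mgf_pos[OF assms(1)] by (simp add: a_def tilt_def)
    then show ?thesis by (simp add: algebra_simps)
  qed
  also have "\<dots> = (\<integral>xi. exp a * ((1 - a) * exp (l * X xi) + (l' - l) * (X xi * exp (l * X xi))) \<partial>M)"
    using int by (simp add: mgf_def)
  also have "\<dots> \<le> mgf l'"
    unfolding mgf_def
  proof (intro integral_mono)
    fix xi
    have "1 + ((l' - l) * X xi - a) \<le> exp ((l' - l) * X xi - a)" by (rule exp_ge_add_one_self)
    then have "exp (a + l * X xi) * (1 + ((l' - l) * X xi - a)) \<le> exp (a + l * X xi) * exp ((l' - l) * X xi - a)"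
      by (intro mult_left_mono) auto
    then show "exp a * ((1 - a) * exp (l * X xi) + (l' - l) * (X xi * exp (l * X xi))) \<le> exp (l' * X xi)"
      by (simp add: exp_add[symmetric]) (simp add: exp_add algebra_simps)
  qed (use int in auto)
  finally have "exp (a + LLambda M p l) \<le> exp (LLambda M p l')"
    using assms by (simp add: mgf_eq_exp exp_add)
  then show ?thesis by (simp add: a_def mult.commute)
qed

text \<open>Add the tangent inequalities at the two points.\<close>

lemma tilt_mono:
  assumes "l \<le> l'" "l' \<le> 0"
  shows "tilt l \<le> tilt l'"
proof (cases "l = l'")
  case False
  have "(l' - l) * tilt l \<le> (l' - l) * tilt l'"
    using LLambda_tangent[of l l'] LLambda_tangent[of l' l] assms by (simp add: algebra_simps)
  then show ?thesis using False assms by simp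
qed simp

text \<open>\<open>X\<close> is almost surely nonnegative and not almost surely zero, and the
  exponential weight is strictly positive.\<close>

lemma tilt_pos:
  assumes l: "l \<le> 0" and X: "0 < (\<integral>xi. X xi \<partial>M)"
  shows "0 < tilt l"
proof -
  have int: "integrable M (\<lambda>xi. X xi * exp (l * X xi))"
    using l u_pos integrable_X_exp[OF u_moment, of l] by auto
  have nn: "AE xi in M. 0 \<le> X xi * exp (l * X xi)"
    using AE_X_nonneg by (rule eventually_mono) simp
  have "(\<integral>xi. X xi * exp (l * X xi) \<partial>M) \<noteq> 0"
  proof
    assume "(\<integral>xi. X xi * exp (l * X xi) \<partial>M) = 0"
    then have "AE xi in M. X xi * exp (l * X xi) = 0"
      using integral_nonneg_eq_0_iff_AE[OF int nn] by simp
    then have "(\<integral>xi. X xi \<partial>M) = (\<integral>xi. 0 \<partial>M)"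
      by (intro integral_cong_AE) (auto elim: eventually_mono)
    then show False using X by simp
  qed
  with integral_nonneg_AE[OF nn] have "0 < (\<integral>xi. X xi * exp (l * X xi) \<partial>M)" by simp
  then show ?thesis using mgf_pos[OF l] by (simp add: tilt_def)
qed

end

section \<open>The rate\<close>

locale branching_rate = branching_env_moment +
  fixes k :: nat and r theta :: real
  assumes k: "1 \<le> k" and r_pos: "0 < r" and gam_pos: "0 < gam M p k"
    and r_def: "mgf (- r) = gam M p k"
    and theta: "0 < theta" "theta < (\<integral>xi. X xi \<partial>M)"
begin

abbreviation "LL \<equiv> LLambda M p"

text \<open>The concave objective of the Legendre transform, which \<open>chi\<close> shares on
  \<open>[- r, 0]\<close>.\<close>

definition G :: "real \<Rightarrow> real" where
  "G l = l * theta - LL l"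

lemma G_deriv: "l \<le> 0 \<Longrightarrow> (G has_real_derivative theta - tilt l) (at l)"
  unfolding G_def by (auto intro!: derivative_eq_intros DERIV_LLambda)

lemma G_tangent: "l \<le> 0 \<Longrightarrow> l' \<le> 0 \<Longrightarrow> G l' \<le> G l + (theta - tilt l) * (l' - l)"
  using LLambda_tangent[of l l'] by (simp add: G_def algebra_simps)

lemma LL_r: "LL (- r) = ln (gam M p k)"
  by (simp add: LLambda_eq r_def)

lemma LL_gt:
  assumes "- r < l" "l \<le> 0"
  shows "ln (gam M p k) < LL l"
proof -
  have "0 < tilt (- r) * (l - - r)"
    using r_pos theta assms by (intro mult_pos_pos tilt_pos) auto
  then show ?thesis using LLambda_tangent[of "- r" l] assms r_pos by (simp add: LL_r)
qed

text \<open>For orders below \<open>r\<close>, staying put is cheaper to dominate than growth, so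
  \<open>mgf (- s)\<close> alone decides which \<open>rho\<close> the Lyapunov function
  admits.\<close>

lemma gam_less_mgf: "0 < s \<Longrightarrow> s < r \<Longrightarrow> gam M p k < mgf (- s)"
  using LL_gt[of "- s"] gam_pos mgf_pos[of "- s"] by (simp add: LLambda_eq)

definition opt :: real where
  "opt = (SOME l. l \<in> {- r..<0} \<and> 0 < G l \<and> (\<forall>l'\<in>{- r..0}. G l' \<le> G l))"

text \<open>A maximiser exists by compactness. Since \<open>theta\<close> lies below the mean of
  \<open>X\<close>, \<open>G\<close> increases to the left of 0, so the maximum is positive and not
  attained at 0.\<close>

lemma opt: "- r \<le> opt" "opt < 0" "0 < G opt" "\<And>l. - r \<le> l \<Longrightarrow> l \<le> 0 \<Longrightarrow> G l \<le> G opt"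
proof -
  have G0: "G 0 = 0" by (simp add: G_def LLambda_0)
  obtain d where d: "0 < d" "\<And>h. 0 < h \<Longrightarrow> h < d \<Longrightarrow> G 0 < G (0 - h)"
    using DERIV_neg_dec_left[OF G_deriv[of 0]] theta by (auto simp: tilt_0)
  define h where "h = min d r / 2"
  have h: "0 < h" "h < d" "h < r" using d r_pos by (auto simp: h_def)
  have "continuous_on {- r..0} G"
    by (intro continuous_at_imp_continuous_on ballI DERIV_isCont[OF G_deriv]) auto
  then obtain l where l: "l \<in> {- r..0}" "\<And>l'. l' \<in> {- r..0} \<Longrightarrow> G l' \<le> G l"
    using continuous_attains_sup[of "{- r..0}" G] r_pos by auto
  have "0 < G l" using l(2)[of "- h"] d(2)[of h] h G0 by auto
  then have "l \<in> {- r..<0} \<and> 0 < G l \<and> (\<forall>l'\<in>{- r..0}. G l' \<le> G l)"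
    using l G0 by (auto simp: less_le)
  then have "opt \<in> {- r..<0} \<and> 0 < G opt \<and> (\<forall>l'\<in>{- r..0}. G l' \<le> G opt)"
    unfolding opt_def by (rule someI)
  then show "- r \<le> opt" "opt < 0" "0 < G opt" "\<And>l. - r \<le> l \<Longrightarrow> l \<le> 0 \<Longrightarrow> G l \<le> G opt" by auto
qed

lemma tilt_opt:
  assumes "- r < opt"
  shows "tilt opt = theta"
proof -
  have "theta - tilt opt = 0"
  proof (rule DERIV_local_max[OF G_deriv, of _ "min (opt + r) (- opt)"])
    show "\<forall>y. \<bar>opt - y\<bar> < min (opt + r) (- opt) \<longrightarrow> G y \<le> G opt"
      using opt(4) by (auto simp: abs_less_iff)
  qed (use opt assms in auto)
  then show ?thesis by simp
qed

lemma tilt_opt_boundary: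
  assumes "opt = - r"
  shows "theta \<le> tilt (- r)"
proof (rule ccontr)
  assume "\<not> theta \<le> tilt (- r)"
  then obtain d where d: "0 < d" "\<And>h. 0 < h \<Longrightarrow> h < d \<Longrightarrow> G (- r) < G (- r + h)"
    using DERIV_pos_inc_right[OF G_deriv[of "- r"]] r_pos by auto
  define h where "h = min d r / 2"
  have h: "0 < h" "h < d" "h < r" using d r_pos by (auto simp: h_def)
  show False using d(2)[OF h(1,2)] opt(4)[of "- r + h"] h assms by auto
qed

text \<open>Left of \<open>- r\<close> the function \<open>chi\<close> is constant while
  \<open>l * theta\<close> increases in \<open>l\<close>, so no such point beats
  \<open>- r\<close>.\<close>

lemma chi_star_eq: "chi_star M p k r theta = ereal (G opt)"
  unfolding chi_star_def
proof (rule antisym)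
  show "(SUP l\<in>{..0}. ereal (l * theta - chi M p k r l)) \<le> ereal (G opt)"
  proof (rule SUP_least)
    fix l :: real assume "l \<in> {..0}"
    then have "l * theta - chi M p k r l \<le> G (max l (- r))"
      using theta mult_right_mono[of l "- r" theta] by (auto simp: chi_def G_def LL_r max_def)
    also have "\<dots> \<le> G opt" using \<open>l \<in> {..0}\<close> r_pos by (intro opt(4)) auto
    finally show "ereal (l * theta - chi M p k r l) \<le> ereal (G opt)" by simp
  qed
  have "G opt = opt * theta - chi M p k r opt"
    using opt(1) by (auto simp: G_def chi_def LL_r)
  then show "ereal (G opt) \<le> (SUP l\<in>{..0}. ereal (l * theta - chi M p k r l))"
    using opt(2) by (auto intro!: SUP_upper2[of opt])
qed

text \<open>By concavity the slope \<open>theta - tilt (- r)\<close> decides: if negative,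
  \<open>G\<close> is maximal on \<open>[- r, 0]\<close> at \<open>- r\<close>; otherwise no point
  left of \<open>- r\<close> exceeds \<open>G (- r)\<close>, and the supremum over the half-line is
  unchanged.\<close>

lemma G_opt_cases:
  "ereal (G opt) = (if theta < deriv LL (- r) then ereal (- r * theta - ln (gam M p k))
     else LLambda_star M p theta)"
proof -
  have der: "deriv LL (- r) = tilt (- r)"
    using r_pos by (intro DERIV_imp_deriv DERIV_LLambda) auto
  show ?thesis
  proof (cases "theta < tilt (- r)")
    case True
    have "(theta - tilt (- r)) * (opt - - r) \<le> 0"
      using True opt by (intro mult_nonpos_nonneg) auto
    then have "G opt \<le> G (- r)" using G_tangent[of "- r" opt] opt r_pos by simp
    then have "G opt = G (- r)" using opt(4)[of "- r"] r_pos by simp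
    then show ?thesis using True by (simp add: der G_def LL_r)
  next
    case False
    have "(SUP l\<in>{..0}. ereal (G l)) = ereal (G opt)"
    proof (rule antisym[OF SUP_least])
      fix l :: real assume l: "l \<in> {..0}"
      show "ereal (G l) \<le> ereal (G opt)"
      proof (cases "- r \<le> l")
        case l': False
        have "(theta - tilt (- r)) * (l - - r) \<le> 0"
          using False l' by (intro mult_nonneg_nonpos) auto
        then have "G l \<le> G (- r)" using G_tangent[of "- r" l] l r_pos by simp
        also have "\<dots> \<le> G opt" using r_pos by (intro opt(4)) auto
        finally show ?thesis by simp
      qed (use l opt in auto)
    qed (use opt(2) in \<open>auto intro: SUP_upper\<close>)
    then show ?thesis using False by (simp add: der LLambda_star_def G_def)
  qed
qed

section \<open>Matching bounds for the lower deviation probability\<close>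

definition prb :: "nat \<Rightarrow> real" where
  "prb n = annP M p k n {z. real z \<le> exp (theta * real n)}"

text \<open>The optimal strategy: the population stays at \<open>k\<close> for a time \<open>(1 - theta / y) n\<close> and
  then grows at the exponential rate \<open>y\<close>.\<close>
lemma strategy:
  assumes "G opt < c"
  obtains s where "0 < s" "s < r" "theta \<le> tilt (- s)"
    "(1 - theta / tilt (- s)) * (- ln (gam M p k))
      + theta / tilt (- s) * (- s * tilt (- s) - LL (- s)) < c"
proof (cases "opt = - r")
  case True
  \<comment> \<open>\<open>annP_lower\<close> needs an order strictly below \<open>r\<close>; moving
    off the boundary by \<open>h\<close> costs at most \<open>h * theta\<close>, which fits into the
    slack.\<close>
  define h where "h = min ((c - G opt) / theta) r / 2"
  have h: "0 < h" "h < r" "h * theta < c - G opt"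
    using assms theta r_pos by (auto simp: h_def min_def field_simps)
  let ?s = "r - h" let ?y = "tilt (- ?s)"
  have y: "theta \<le> ?y"
    using tilt_opt_boundary[OF True] tilt_mono[of "- r" "- ?s"] h by simp
  have "theta / ?y * (LL (- ?s) - ln (gam M p k)) \<ge> 0"
    using LL_gt[of "- ?s"] h y theta by (intro mult_nonneg_nonneg) auto
  moreover have "theta / ?y * (?s * ?y) = ?s * theta" using y theta by simp
  moreover have "(1 - theta / ?y) * (- ln (gam M p k)) + theta / ?y * (- ?s * ?y - LL (- ?s))
      = - ln (gam M p k) - theta / ?y * (?s * ?y) - theta / ?y * (LL (- ?s) - ln (gam M p k))"
    by (simp add: algebra_simps)
  moreover have "- ln (gam M p k) - ?s * theta = G opt + h * theta"
    by (simp add: True G_def LL_r algebra_simps)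
  ultimately show ?thesis using h y that[of ?s] by simp
next
  case False
  \<comment> \<open>At an interior optimum the growth rate is \<open>theta\<close> itself, so there
    is no waiting period.\<close>
  then have "- r < opt" using opt(1) by simp
  then show ?thesis
    using that[of "- opt"] tilt_opt opt(2) theta assms by (simp add: G_def)
qed

text \<open>Positivity is part of the claim because \<open>prb_upper\<close> takes logarithms of
  \<open>prb n\<close>.\<close>

lemma prb_lower:
  assumes c: "G opt < c"
  shows "\<forall>\<^sub>F n in sequentially. 0 < prb n \<and> - ln (prb n) / real n < c"
proof -
  obtain s where s: "0 < s" "s < r" "theta \<le> tilt (- s)"
    and sc: "(1 - theta / tilt (- s)) * (- ln (gam M p k))
      + theta / tilt (- s) * (- s * tilt (- s) - LL (- s)) < c"
    using strategy[OF c] by metis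
  define y where "y = tilt (- s)"
  have y: "theta \<le> y" "0 < y" using s theta by (auto simp: y_def)
  \<comment> \<open>The cost per generation when a share \<open>t\<close> of the time is spent
    growing, with tolerance \<open>d\<close>; at \<open>d = 0\<close> it is the cost in
    \<open>strategy\<close>.\<close>
  define b where "b = (\<lambda>t d. (1 - t) * (- ln (gam M p k)) + t * (- s * (y - d) - LL (- s) + d))"
  have "((\<lambda>d. b (theta / (y + d)) d) \<longlongrightarrow> b (theta / (y + 0)) 0) (at_right 0)"
    unfolding b_def using y by (intro tendsto_intros) auto
  moreover have "b (theta / (y + 0)) 0 < c" using sc by (simp add: b_def y_def)
  ultimately have "\<forall>\<^sub>F d in at_right 0. b (theta / (y + d)) d < c"
    by (rule order_tendstoD)
  with eventually_at_right_less have "\<forall>\<^sub>F d in at_right 0. 0 < d \<and> b (theta / (y + d)) d < c"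
    by (rule eventually_conj)
  then obtain d where d: "0 < d" "b (theta / (y + d)) d < c"
    using eventually_happens[of _ "at_right (0::real)"] by auto
  \<comment> \<open>Growth at rate \<open>y + d\<close> for a share \<open>a\<close> of the time
    reaches exactly \<open>theta\<close>; rounding down in \<open>N\<close> keeps the population
    below the target.\<close>
  define a where "a = theta / (y + d)"
  have a: "0 < a" "a \<le> 1" using y d theta by (auto simp: a_def)
  define N where "N = (\<lambda>n. nat \<lfloor>a * real n\<rfloor>)"
  have N_le: "real (N n) \<le> a * real n" for n
    using a by (simp add: N_def)
  have N_ge: "a * real n - 1 \<le> real (N n)" for n
    unfolding N_def by linarith
  have N_n: "N n \<le> n" for n
  proof -
    have "a * real n \<le> 1 * real n" using a by (intro mult_right_mono) auto
    then show ?thesis using N_le[of n] by simp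
  qed
  have "filterlim (\<lambda>n. a * real n) at_top sequentially"
    using a by (intro filterlim_tendsto_pos_mult_at_top[OF tendsto_const] filterlim_real_sequentially)
  then have N_top: "filterlim N at_top sequentially"
    unfolding N_def
    by (intro filterlim_compose[OF filterlim_nat_sequentially] filterlim_compose[OF filterlim_floor_sequentially])
  have N_lim: "(\<lambda>n. real (N n) / real n) \<longlonglongrightarrow> a"
  proof (rule tendsto_sandwich)
    have "(\<lambda>n. a - 1 / real n) \<longlonglongrightarrow> a - 0" by (intro tendsto_intros lim_1_over_n)
    then show "(\<lambda>n. a - 1 / real n) \<longlonglongrightarrow> a" by simp
    show "\<forall>\<^sub>F n in sequentially. a - 1 / real n \<le> real (N n) / real n"
      using eventually_gt_at_top[of 0]
    proof eventually_elim
      case (elim n)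
      have "(a * real n - 1) / real n \<le> real (N n) / real n"
        by (intro divide_right_mono N_ge) simp
      then show ?case using elim by (simp add: diff_divide_distrib)
    qed
    show "\<forall>\<^sub>F n in sequentially. real (N n) / real n \<le> a"
      using eventually_gt_at_top[of 0] by eventually_elim (use N_le in \<open>simp add: field_simps\<close>)
  qed simp
  have "(\<lambda>n. b (real (N n) / real n) d) \<longlonglongrightarrow> b a d"
    unfolding b_def by (intro tendsto_intros N_lim)
  then have "\<forall>\<^sub>F n in sequentially. b (real (N n) / real n) d < c"
    using d by (intro order_tendstoD) (auto simp: a_def)
  moreover have "\<forall>\<^sub>F n in sequentially. exp (real (N n) * (s * (y - d) + LL (- s) - d))
      \<le> annP M p k (N n) {z. real z \<le> exp ((y + d) * real (N n))}"
    using N_top annP_lower[OF k s(1,2) gam_less_mgf DERIV_LLambda d(1)] s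
    unfolding y_def by (auto simp: filterlim_iff)
  ultimately show ?thesis
    using eventually_gt_at_top[of 0]
  proof eventually_elim
    case (elim n)
    let ?E = "real (N n) * (s * (y - d) + LL (- s) - d)"
    have "(y + d) * real (N n) \<le> (y + d) * (a * real n)"
      using y d N_le by (intro mult_left_mono) auto
    also have "\<dots> = theta * real n" using y d by (simp add: a_def)
    finally have sub: "(y + d) * real (N n) \<le> theta * real n" .
    have "gam M p k ^ (n - N n) * exp ?E
        \<le> gam M p k ^ (n - N n) * annP M p k (N n) {z. real z \<le> exp ((y + d) * real (N n))}"
      using elim gam_pos by (intro mult_left_mono) auto
    also have "\<dots> \<le> gam M p k ^ (n - N n) * annP M p k (N n) {z. real z \<le> exp (theta * real n)}"
      using gam_pos sub by (intro mult_left_mono annP_mono) (auto elim: order_trans)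
    also have "\<dots> \<le> prb n" unfolding prb_def by (intro annP_stay N_n)
    finally have le: "gam M p k ^ (n - N n) * exp ?E \<le> prb n" .
    moreover have pos: "0 < gam M p k ^ (n - N n) * exp ?E" using gam_pos by simp
    ultimately have "0 < prb n" by linarith
    have "ln (gam M p k ^ (n - N n) * exp ?E) \<le> ln (prb n)"
      using ln_mono[OF le pos] .
    then have "- ln (prb n) \<le> (real n - real (N n)) * (- ln (gam M p k)) - ?E"
      using gam_pos N_n[of n] by (simp add: ln_mult ln_realpow of_nat_diff)
    then have "- ln (prb n) / real n \<le> ((real n - real (N n)) * (- ln (gam M p k)) - ?E) / real n"
      using elim by (intro divide_right_mono) auto
    also have "\<dots> = b (real (N n) / real n) d"
      using elim by (simp add: b_def field_simps)
    finally show ?case using elim \<open>0 < prb n\<close> by simp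
  qed
qed

lemma prb_upper:
  assumes c: "c < G opt"
  shows "\<forall>\<^sub>F n in sequentially. c < - ln (prb n) / real n"
proof -
  \<comment> \<open>\<open>gam_less_mgf\<close> requires an order strictly below \<open>r\<close>,
    so \<open>opt\<close>, possibly equal to \<open>- r\<close>, is replaced by a nearby larger
    point with \<open>G\<close> still above \<open>c\<close>.\<close>
  have "isCont G opt" using opt by (intro DERIV_isCont[OF G_deriv]) auto
  then have "(G \<longlongrightarrow> G opt) (at_right opt)"
    unfolding isCont_def by (rule filterlim_mono[OF _ order_refl at_within_le_at])
  then have "\<forall>\<^sub>F l in at_right opt. c < G l" using c by (intro order_tendstoD)
  moreover have "\<forall>\<^sub>F l in at_right opt. opt < l \<and> l < 0"
    using eventually_at_right_real[OF opt(2)] by simp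
  ultimately obtain l where l: "c < G l" "opt < l" "l < 0"
    using eventually_happens[OF eventually_conj] trivial_limit_at_right_real by blast
  define s where "s = - l"
  have s: "0 < s" "s < r" using l opt(1) by (auto simp: s_def)
  obtain c' where c': "c < c'" "c' < G l" using dense[OF l(1)] by blast
  \<comment> \<open>Exceeds \<open>mgf (- s)\<close> because \<open>c' < G l\<close>; its factor
    \<open>exp (- s * theta)\<close> cancels the \<open>powr s\<close> in Markov's bound.\<close>
  define rho where "rho = exp (- c' - s * theta)"
  have "mgf (- s) < rho"
    using c' s by (simp add: mgf_eq_exp rho_def G_def s_def)
  then have "gam M p k < rho" using gam_less_mgf[OF s] by simp
  then obtain C where C: "0 \<le> C" "\<And>n x. 0 < x \<Longrightarrow> annP M p k n {z. real z \<le> x} \<le> C * rho ^ n * x powr s"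
    using annP_upper[OF s(1) k _ \<open>mgf (- s) < rho\<close>] by metis
  have "(\<lambda>n. c' - ln C * (1 / real n)) \<longlonglongrightarrow> c' - ln C * 0"
    by (intro tendsto_intros lim_1_over_n)
  then have "\<forall>\<^sub>F n in sequentially. c < c' - ln C * (1 / real n)"
    using c' by (intro order_tendstoD) auto
  moreover have "\<forall>\<^sub>F n in sequentially. 0 < prb n"
    using prb_lower[of "G opt + 1"] by (auto elim: eventually_mono)
  ultimately show ?thesis
    using eventually_gt_at_top[of 0]
  proof eventually_elim
    case (elim n)
    have "prb n \<le> C * rho ^ n * exp (theta * real n) powr s"
      unfolding prb_def by (rule C) simp
    also have "\<dots> = C * exp (- c' * real n)"
      by (simp add: rho_def powr_def exp_of_nat_mult[symmetric] exp_add[symmetric] algebra_simps)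
    finally have le: "prb n \<le> C * exp (- c' * real n)" .
    then have "0 < C" using elim C(1) by (cases "C = 0") auto
    have "ln (prb n) \<le> ln (C * exp (- c' * real n))"
      using le elim by (intro ln_mono) auto
    also have "\<dots> = ln C - c' * real n" using \<open>0 < C\<close> by (simp add: ln_mult)
    finally have "(c' * real n - ln C) / real n \<le> - ln (prb n) / real n"
      by (intro divide_right_mono) auto
    moreover have "(c' * real n - ln C) / real n = c' - ln C * (1 / real n)"
      using elim by (simp add: field_simps)
    ultimately show ?case using elim by simp
  qed
qed

lemma prb_tendsto: "(\<lambda>n. - ln (prb n) / real n) \<longlonglongrightarrow> G opt"
proof (rule order_tendstoI)
  fix c assume "G opt < c"
  from prb_lower[OF this] show "\<forall>\<^sub>F n in sequentially. - ln (prb n) / real n < c"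
    by (rule eventually_mono) simp
qed (rule prb_upper)

end

theorem theorem2p3:
  fixes M :: "'e measure" and p :: "'e \<Rightarrow> nat \<Rightarrow> real"
    and k :: nat and r eps theta :: real
  assumes M: "prob_space M"
    and p_meas: "\<And>i. (\<lambda>xi. p xi i) \<in> borel_measurable M"
    and p_nonneg: "\<And>xi i. xi \<in> space M \<Longrightarrow> 0 \<le> p xi i"
    and p_sums: "\<And>xi. xi \<in> space M \<Longrightarrow> p xi sums 1"
    and p0: "AE xi in M. p xi 0 = 0"
    and mean_fin: "AE xi in M. summable (\<lambda>i. real i * p xi i)"
    and X_int: "integrable M (\<lambda>xi. ln (mean p xi))"
    and X_pos: "(\<integral>xi. ln (mean p xi) \<partial>M) > 0"
    and LlogL: "(\<integral>\<^sup>+xi. (\<Sum>i. ennreal (p xi i * real i / mean p xi * max 0 (ln (real i)))) \<partial>M) < \<infinity>"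
    and p1: "measure M {xi \<in> space M. p xi 1 > 0} > 0"
    and k: "k \<ge> 1"
    and r_pos: "r > 0"
    and r_def: "(\<integral>xi. mean p xi powr (- r) \<partial>M) = gam M p k"
    and eps: "eps > 0"
    and moment: "integrable M (\<lambda>xi. mean p xi powr (r + eps))"
    and theta: "0 < theta" "theta < (\<integral>xi. ln (mean p xi) \<partial>M)"
  shows "chi_star M p k r theta =
           (if theta < deriv (LLambda M p) (- r)
            then ereal (- r * theta - ln (gam M p k))
            else LLambda_star M p theta)
      \<and> 0 < chi_star M p k r theta \<and> chi_star M p k r theta < \<infinity>
      \<and> (\<lambda>n. ereal (- ln (annP M p k n {z. real z \<le> exp (theta * real n)}) / real n))
           \<longlonglongrightarrow> chi_star M p k r theta"
proof -
  interpret prob_space M by (rule M)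
  interpret branching_env M p
    using p_meas p_nonneg p_sums p0 mean_fin by unfold_locales
  \<comment> \<open>The mean is almost surely at least 1, hence positive, so the two forms of the
    power agree.\<close>
  have powr: "AE xi in M. mean p xi powr l = exp (l * ln (mean p xi))" for l
    using AE_good by (rule eventually_mono) (simp add: good_def powr_def)
  have r: "mgf (- r) = gam M p k"
    unfolding mgf_def r_def[symmetric]
    by (rule integral_cong_AE) (use powr[of "- r"] in \<open>auto elim: eventually_mono\<close>)
  have "integrable M (\<lambda>xi. exp ((r + eps) * ln (mean p xi)))"
    by (rule Bochner_Integration.integrable_bound[OF moment])
      (use powr[of "r + eps"] in \<open>auto elim: eventually_mono\<close>)
  then interpret branching_env_moment M p "r + eps"
    using r_pos eps by unfold_locales auto
  have "gam M p k \<noteq> 0"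
  proof
    assume "gam M p k = 0"
    then have "AE xi in M. p xi 1 ^ k = 0"
      unfolding gam_def
      by (subst (asm) integral_nonneg_eq_0_iff_AE) (auto simp: integrable_p_power p_nonneg)
    then have "AE xi in M. \<not> 0 < p xi 1" by eventually_elim (use k in auto)
    then have "measure M {xi \<in> space M. p xi 1 > 0} = 0"
      by (subst prob_eq_0) auto
    then show False using p1 by simp
  qed
  then have "0 < gam M p k" using gam_nonneg[of k] by simp
  then interpret branching_rate M p "r + eps" k r theta
    using k r_pos r theta by unfold_locales auto
  show ?thesis
    using tendsto_ereal[OF prb_tendsto] opt(3)
    unfolding chi_star_eq G_opt_cases[symmetric] prb_def by simp
qed

end
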